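(* Let $V$ be a finite dimensional real vector space with lattice $\Lambda$, let $T=V^*/\Lambda^*$, and let $m\in\mathcal{S}(\Lambda)$. For $g\in T$ of finite order let $m^g(\lambda,k)=g^{\lambda}m(\lambda,k)$, which is again in $\mathcal{S}(\Lambda)$. If $A(m^g)=0$ for all $g\in T$ of finite order, then $m=0$.
   Context: $\Lambda^*\subset V^*$ is the dual lattice. For $g\in T=V^*/\Lambda^*$ with representative $G\in V^*$ and $\lambda\in\Lambda$, $g^\lambda:=e^{2i\pi\langle G,\lambda\rangle}$. A function on a lattice $L$ is periodic if there is a positive integer $D$ such that it is invariant under translation by $DL$. The algebra of quasi-polynomial functions on $L$ is the algebra of (complex valued) functions on $L$ generated by polynomials and periodic functions; this is used in particular for $L=\Lambda\oplus\mathbb{Z}$, whose elements are written $(\lambda,k)$. For a rational polyhedron $P\subset V$ (possibly with empty interior, possibly unbounded), let $C_P=\{(t\xi,t): t\ge 0,\ \xi\in P\}\subset V\oplus\mathbb{R}$ and let $[C_P]$ be its characteristic function. For $q$ a quasi-polynomial function on $\Lambda\oplus\mathbb{Z}$, $q[C_P]$ is the function on $\Lambda\oplus\mathbb{Z}$ equal to $q(\lambda,k)$ if $(\lambda,k)\in C_P$ and to $0$ otherwise. $\mathcal{S}(\Lambda)$ is the space of functions on $\Lambda\oplus\mathbb{Z}$ linearly generated by the functions $q[C_P]$, for $P$ any rational polyhedron in $V$ and $q$ any quasi-polynomial function on $\Lambda\oplus\mathbb{Z}$. For $m\in\mathcal{S}(\Lambda)$ and an integer $k\ge1$, $\Theta(m)(k)$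 is the distribution on $V$ given on test functions $\varphi$ (smooth, compactly supported) by $\langle\Theta(m)(k),\varphi\rangle=\sum_{\lambda\in\Lambda}m(\lambda,k)\varphi(\lambda/k)$. A family $\theta(k)$ of distributions depending on an integer $k$ is periodic in $k$ if there is a positive integer $D$ with $\langle\theta(k_0+Dk),\varphi\rangle=\langle\theta(k_0),\varphi\rangle$ for all integers $k_0,k$ and all test functions $\varphi$. A sequence $(\Theta(k))_{k\ge1}$ of distributions on $V$ admits an asymptotic expansion if there exist $n_0\in\mathbb{Z}$ and distributions $\theta_n(k)$, $n\ge0$, each periodic in $k$, such that for every test function $\varphi$ and every integer $N\ge0$, $$\langle\Theta(k),\varphi\rangle=k^{n_0}\sum_{n=0}^N\frac{1}{k^n}\langle\theta_n(k),\varphi\rangle+o(k^{n_0-N})\quad (k\to\infty).$$ The $\theta_n(k)$ are then uniquely determined (given $n_0$). For every $m\in\mathcal{S}(\Lambda)$ the sequence $\Theta(m)(k)$ admits such an asymptotic expansion, and $A(m)$ denotes the resulting formal series $k^{n_0}\sum_{n\ge0}k^{-n}\theta_n(k)$. $A(m)=0$ means that all the $\theta_n(k)$ vanish. *)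

theory Defs
  imports "HOL-Analysis.Analysis" "HOL-Library.Landau_Symbols"
begin

section \<open>Lattices, dual lattices and the dual torus\<close>

text \<open>
  The vector space \<open>V\<close> is a type \<open>'a\<close> of class \<^class>\<open>real_normed_vector\<close> carrying a lattice in
  the sense below.  The lattice has a finite basis which is a basis of \<open>V\<close>, so \<open>V\<close> is
  finite-dimensional (dimension 0 is not excluded).  The norm only supplies the topology, and all
  norms on a finite-dimensional space give the same one.
\<close>

definition is_lattice :: "'a::real_vector set \<Rightarrow> bool" where
  "is_lattice \<Lambda> \<longleftrightarrow> (\<exists>B. finite B \<and> independent B \<and> span B = UNIV \<and>
     \<Lambda> = range (\<lambda>c :: 'a \<Rightarrow> int. \<Sum>b\<in>B. of_int (c b) *\<^sub>R b))"

definition dual_space :: "('a::real_vector \<Rightarrow> real) set" where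
  "dual_space = {G. linear G}"

definition dual_lattice :: "'a::real_vector set \<Rightarrow> ('a \<Rightarrow> real) set" where
  "dual_lattice \<Lambda> = {G \<in> dual_space. \<forall>\<mu>\<in>\<Lambda>. G \<mu> \<in> \<int>}"

definition torus :: "'a::real_vector set \<Rightarrow> ('a \<Rightarrow> real) set set" where
  "torus \<Lambda> = dual_space //
     {(G, H). G \<in> dual_space \<and> H \<in> dual_space \<and> (\<lambda>x. G x - H x) \<in> dual_lattice \<Lambda>}"

text \<open>For a class \<open>g\<close> with representative \<open>G\<close>, the class of \<open>n G\<close> is trivial for some \<open>n > 0\<close>.\<close>

definition finite_order :: "'a::real_vector set \<Rightarrow> ('a \<Rightarrow> real) set \<Rightarrow> bool" where
  "finite_order \<Lambda> g \<longleftrightarrow> (\<exists>n::nat. n > 0 \<and> (\<forall>G\<in>g. (\<lambda>x. real n * G x) \<in> dual_lattice \<Lambda>))"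

text \<open>For \<open>g\<close> in the torus and \<open>\<mu>\<close> in the lattice the value does not depend on the chosen
  representative; it is only used for such arguments.\<close>

definition torus_power :: "('a \<Rightarrow> real) set \<Rightarrow> 'a \<Rightarrow> complex" where
  "torus_power g \<mu> = exp (2 * \<i> * of_real pi * of_real ((SOME G. G \<in> g) \<mu>))"


section \<open>Quasi-polynomial functions and the space S\<close>

text \<open>
  A function on a lattice \<open>L\<close> of a vector space \<open>W\<close> is represented by a total function on \<open>W\<close>.
  In \<open>lattice_periodic\<close> and \<open>quasi_polynomial\<close> the values off \<open>L\<close> are irrelevant (any function
  vanishing on \<open>L\<close> is periodic, hence quasi-polynomial), whereas \<open>m\<close> in the space \<open>space_S\<close> is
  extended by 0 off \<open>L\<close>, so that equality of total functions is equality on \<open>L\<close>.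
\<close>

definition lattice_periodic :: "'w::real_vector set \<Rightarrow> ('w \<Rightarrow> complex) \<Rightarrow> bool" where
  "lattice_periodic L f \<longleftrightarrow>
     (\<exists>D::nat. D > 0 \<and> (\<forall>x\<in>L. \<forall>y\<in>L. f (x + real D *\<^sub>R y) = f x))"

text \<open>Scalar multiplication needs no rule of its own: constants are polynomial functions.\<close>

inductive quasi_polynomial :: "'w::real_normed_vector set \<Rightarrow> ('w \<Rightarrow> complex) \<Rightarrow> bool"
  for L where
    polynomial: "polynomial_function p \<Longrightarrow> quasi_polynomial L p"
  | periodic: "lattice_periodic L f \<Longrightarrow> quasi_polynomial L f"
  | add: "quasi_polynomial L f \<Longrightarrow> quasi_polynomial L g \<Longrightarrow> quasi_polynomial L (\<lambda>x. f x + g x)"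
  | mult: "quasi_polynomial L f \<Longrightarrow> quasi_polynomial L g \<Longrightarrow> quasi_polynomial L (\<lambda>x. f x * g x)"

text \<open>A pair \<open>(l, c)\<close> stands for the half-space \<open>l x \<le> c\<close>.\<close>

definition rational_polyhedron :: "'a::real_vector set \<Rightarrow> 'a set \<Rightarrow> bool" where
  "rational_polyhedron \<Lambda> P \<longleftrightarrow>
     (\<exists>F :: (('a \<Rightarrow> real) \<times> real) set. finite F \<and>
        (\<forall>(l, c)\<in>F. l \<in> dual_space \<and> (\<forall>\<mu>\<in>\<Lambda>. l \<mu> \<in> \<rat>) \<and> c \<in> \<rat>) \<and>
        P = {x. \<forall>(l, c)\<in>F. l x \<le> c})"

definition cone_over :: "'a::real_vector set \<Rightarrow> ('a \<times> real) set" where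
  "cone_over P = {(t *\<^sub>R \<xi>, t) | t \<xi>. t \<ge> 0 \<and> \<xi> \<in> P}"

text \<open>The lattice \<open>\<Lambda> \<oplus> \<int>\<close>, inside \<open>V \<oplus> \<real>\<close>.\<close>

definition ext_lattice :: "'a set \<Rightarrow> ('a \<times> real) set" where
  "ext_lattice \<Lambda> = \<Lambda> \<times> \<int>"

definition restrict_cone ::
  "'a::real_vector set \<Rightarrow> ('a \<times> real \<Rightarrow> complex) \<Rightarrow> 'a set \<Rightarrow> 'a \<times> real \<Rightarrow> complex" where
  "restrict_cone \<Lambda> q P = (\<lambda>x. if x \<in> ext_lattice \<Lambda> \<and> x \<in> cone_over P then q x else 0)"

definition space_S :: "'a::real_normed_vector set \<Rightarrow> ('a \<times> real \<Rightarrow> complex) set" where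
  "space_S \<Lambda> = {m. \<exists>(n::nat) c q P.
     (\<forall>i<n. quasi_polynomial (ext_lattice \<Lambda>) (q i) \<and> rational_polyhedron \<Lambda> (P i)) \<and>
     m = (\<lambda>x. \<Sum>i<n. c i * restrict_cone \<Lambda> (q i) (P i) x)}"

definition twist ::
  "('a \<Rightarrow> real) set \<Rightarrow> ('a \<times> real \<Rightarrow> complex) \<Rightarrow> 'a \<times> real \<Rightarrow> complex" where
  "twist g m = (\<lambda>(\<mu>, k). torus_power g \<mu> * m (\<mu>, k))"


section \<open>Test functions and distributions\<close>

text \<open>Iterated directional derivatives, along the list of vectors.\<close>

primrec dir_deriv ::
  "'a::real_normed_vector list \<Rightarrow> ('a \<Rightarrow> complex) \<Rightarrow> 'a \<Rightarrow> complex" where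
  "dir_deriv [] \<phi> = \<phi>"
| "dir_deriv (v # vs) \<phi> = (\<lambda>x. frechet_derivative (dir_deriv vs \<phi>) (at x) v)"

definition smooth :: "('a::real_normed_vector \<Rightarrow> complex) \<Rightarrow> bool" where
  "smooth \<phi> \<longleftrightarrow> (\<forall>vs x. dir_deriv vs \<phi> differentiable (at x))"

definition supp :: "('a::topological_space \<Rightarrow> complex) \<Rightarrow> 'a set" where
  "supp \<phi> = closure {x. \<phi> x \<noteq> 0}"

definition test_function :: "('a::real_normed_vector \<Rightarrow> complex) \<Rightarrow> bool" where
  "test_function \<phi> \<longleftrightarrow> smooth \<phi> \<and> compact (supp \<phi>)"

text \<open>Continuity of a distribution is expressed by the usual seminorm estimates: on test functions
  supported in a given compact set, it is bounded by finitely many suprema of derivatives.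
  Values of \<open>T\<close> at functions which are not test functions are irrelevant.\<close>

definition distribution :: "(('a::real_normed_vector \<Rightarrow> complex) \<Rightarrow> complex) \<Rightarrow> bool" where
  "distribution T \<longleftrightarrow>
     (\<forall>\<phi> \<psi>. test_function \<phi> \<longrightarrow> test_function \<psi> \<longrightarrow> T (\<lambda>x. \<phi> x + \<psi> x) = T \<phi> + T \<psi>) \<and>
     (\<forall>c \<phi>. test_function \<phi> \<longrightarrow> T (\<lambda>x. c * \<phi> x) = c * T \<phi>) \<and>
     (\<forall>K. compact K \<longrightarrow> (\<exists>C F. finite F \<and>
        (\<forall>\<phi>. test_function \<phi> \<longrightarrow> supp \<phi> \<subseteq> K \<longrightarrow>
           norm (T \<phi>) \<le> C * (\<Sum>vs\<in>F. SUP x. norm (dir_deriv vs \<phi> x)))))"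

definition periodic_distributions ::
  "(int \<Rightarrow> ('a::real_normed_vector \<Rightarrow> complex) \<Rightarrow> complex) \<Rightarrow> bool" where
  "periodic_distributions \<theta> \<longleftrightarrow> (\<exists>D::int. D > 0 \<and>
     (\<forall>k\<^sub>0 k \<phi>. test_function \<phi> \<longrightarrow> \<theta> (k\<^sub>0 + D * k) \<phi> = \<theta> k\<^sub>0 \<phi>))"


section \<open>Asymptotic expansions\<close>

text \<open>For \<open>k \<ge> 1\<close> and a test function \<open>\<phi>\<close> only finitely many terms of this sum are nonzero.\<close>

definition Theta ::
  "'a::real_normed_vector set \<Rightarrow> ('a \<times> real \<Rightarrow> complex) \<Rightarrow> nat \<Rightarrow> ('a \<Rightarrow> complex) \<Rightarrow> complex" where
  "Theta \<Lambda> m k \<phi> = (\<Sum>\<^sub>\<infinity>\<mu>\<in>\<Lambda>. m (\<mu>, real k) * \<phi> (\<mu> /\<^sub>R real k))"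

definition asymptotic_expansion ::
  "(nat \<Rightarrow> ('a::real_normed_vector \<Rightarrow> complex) \<Rightarrow> complex) \<Rightarrow> int \<Rightarrow>
   (nat \<Rightarrow> int \<Rightarrow> ('a \<Rightarrow> complex) \<Rightarrow> complex) \<Rightarrow> bool" where
  "asymptotic_expansion \<Theta> n\<^sub>0 \<theta> \<longleftrightarrow>
     (\<forall>n k. distribution (\<theta> n k)) \<and>
     (\<forall>n. periodic_distributions (\<theta> n)) \<and>
     (\<forall>\<phi> N. test_function \<phi> \<longrightarrow>
        (\<lambda>k::nat. \<Theta> k \<phi> - of_nat k powi n\<^sub>0 * (\<Sum>n\<le>N. 1 / of_nat k ^ n * \<theta> n (int k) \<phi>))
          \<in> o(\<lambda>k. of_nat k powi (n\<^sub>0 - int N)))"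

text \<open>\<open>A_zero \<Lambda> m\<close> is the assertion \<open>A(m) = 0\<close>: the sequence \<open>\<Theta>(m)(k)\<close> has an asymptotic expansion
  all of whose coefficients vanish.  As the coefficients are unique given \<open>n\<^sub>0\<close>, and the zero series
  is the same for all \<open>n\<^sub>0\<close>, the existential quantifiers do not involve a choice.\<close>

definition A_zero :: "'a::real_normed_vector set \<Rightarrow> ('a \<times> real \<Rightarrow> complex) \<Rightarrow> bool" where
  "A_zero \<Lambda> m \<longleftrightarrow> (\<exists>n\<^sub>0 \<theta>. asymptotic_expansion (Theta \<Lambda> m) n\<^sub>0 \<theta> \<and>
     (\<forall>n k \<phi>. test_function \<phi> \<longrightarrow> \<theta> n k \<phi> = 0))"

end

(* Suppose m(\<lambda>, k) is nonzero for some k \<ge> 1, and choose (\<lambda>1, k1) of this kind such that as few as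
   possible of the inequalities defining the polyhedra are equalities at \<xi>1 = \<lambda>1 / k1. Near \<xi>1 the
   support of m then lies over the relatively open face through \<xi>1, where m is one quasi-polynomial
   function.  Averaging the hypothesis over the characters of \<Lambda> / D \<Lambda> restricts the sums to a coset
   on which that function is a polynomial, m(\<lambda>, k) = \<Sum>_j k^j R_j(\<lambda> / k).  For the largest J such that
   R_J does not vanish at all relevant rational points of the face, a bump function near a point
   with R_J \<noteq> 0 makes the real part of a constant multiple of the sum bounded below by a positive
   constant along an arithmetic progression of k, whereas the sum tends to 0.

   The remaining value m(0, 0) = \<Sum>{c_i q_i(0, 0) | P_i \<noteq> {}} vanishes because
   \<Sum>{c_i q_i(0, 0) | \<xi> \<in> P_i} = 0 for all \<xi>: this is clear on rational rays, any \<xi> lies in the same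
   polyhedra as some rational point (Dirichlet), and the Euler characteristic, which is 1 on
   nonempty compact convex sets, is additive on indicator functions. *)

theory Submission
  imports Defs "HOL-Computational_Algebra.Polynomial" "HOL-Analysis.Kronecker_Approximation_Theorem"
begin

section \<open>Coordinates with respect to a lattice basis\<close>

text \<open>An expansion controls only weighted sums of m, in which values could cancel, and no
  leading term of these sums is computed. Instead every summand gets a nonnegative real part after
  multiplication by one constant, and a single summand of fixed size contradicts the limit 0. To
  keep that summand, k runs through k0 (1 + D s): then \<xi>0 = \<lambda>0 / k0 is also \<lambda> /
  k for \<lambda> = (1 + D s) \<lambda>0, and (\<lambda>, k) stays in the coset of (\<lambda>0, k0)
  modulo D. Minimality of the number of equalities makes m vanish at nearby rational points off the
  face, where the sign is otherwise uncontrolled.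

  The origin is separate because the hypothesis sees only k \<ge> 1, while (0, 0) lies in the cone
  over every nonempty polyhedron, including those with no common point. The relations at single
  points \<xi> have to be integrated to a global one; this is the role of the Euler characteristic.

  V is only a normed space with a lattice basis, so continuity of coordinates, compact boxes and
  test functions are all built from that basis.\<close>

locale lattice_basis =
  fixes B :: "'a::real_normed_vector set" and \<Lambda> :: "'a set"
  assumes finite_basis: "finite B"
    and independent_basis: "independent B"
    and span_basis: "span B = UNIV"
    and lattice_eq: "\<Lambda> = range (\<lambda>c :: 'a \<Rightarrow> int. \<Sum>b\<in>B. of_int (c b) *\<^sub>R b)"
begin

definition coord :: "'a \<Rightarrow> 'a \<Rightarrow> real" where
  "coord b x = representation B x b"

lemma linear_coord: "linear (coord b)"
  by (rule linearI) (simp_all add: coord_def real_vector.representation_add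
      real_vector.representation_scale independent_basis span_basis)

lemmas coord_simps [simp] =
  linear_add[OF linear_coord] linear_diff[OF linear_coord] linear_scale[OF linear_coord]
  linear_0[OF linear_coord] linear_neg[OF linear_coord]

lemma sum_coord: "(\<Sum>b\<in>B. coord b x *\<^sub>R b) = x"
  unfolding coord_def
  by (rule real_vector.sum_representation_eq) (auto simp: independent_basis span_basis finite_basis)

lemma coord_basis: "a \<in> B \<Longrightarrow> coord b a = (if b = a then 1 else 0)"
  by (simp add: coord_def real_vector.representation_basis independent_basis)

lemma coord_sum: "b \<in> B \<Longrightarrow> coord b (\<Sum>a\<in>B. c a *\<^sub>R a) = c b"
  by (simp add: linear_sum[OF linear_coord] coord_basis finite_basis if_distrib cong: if_cong)

lemma coord_eqI: "(\<And>b. b \<in> B \<Longrightarrow> coord b x = coord b y) \<Longrightarrow> x = y"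
  by (metis (no_types, lifting) sum.cong sum_coord)

lemma linear_coord_expansion: "linear l \<Longrightarrow> l x = (\<Sum>b\<in>B. coord b x * l b)" for l :: "'a \<Rightarrow> real"
  by (subst sum_coord[symmetric, of x], simp add: linear_sum linear_scale)

lemma mem_lattice_iff: "x \<in> \<Lambda> \<longleftrightarrow> (\<forall>b\<in>B. coord b x \<in> \<int>)"
proof
  assume "\<forall>b\<in>B. coord b x \<in> \<int>"
  then have "\<forall>b\<in>B. \<exists>z. coord b x = of_int z"
    by (auto elim: Ints_cases)
  then obtain c where "\<forall>b\<in>B. coord b x = of_int (c b)"
    by metis
  then have "x = (\<Sum>b\<in>B. of_int (c b) *\<^sub>R b)"
    by (metis (no_types, lifting) sum.cong sum_coord)
  then show "x \<in> \<Lambda>"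
    by (auto simp: lattice_eq)
qed (auto simp: lattice_eq coord_sum)

lemma basis_in_lattice: "b \<in> B \<Longrightarrow> b \<in> \<Lambda>"
  by (auto simp: mem_lattice_iff coord_basis)

text \<open>Each further vector contributes a segment, so the box is an iterated Minkowski sum of
  compact segments; no topology on coefficient vectors is involved.\<close>

lemma compact_coefficient_box:
  assumes "finite A"
  shows "compact {x :: 'a. \<exists>c. (\<forall>b\<in>A. \<bar>c b\<bar> \<le> r) \<and> x = (\<Sum>b\<in>A. c b *\<^sub>R b)}"
  using assms
proof induction
  case (insert b A)
  let ?S = "\<lambda>A. {x :: 'a. \<exists>c. (\<forall>b\<in>A. \<bar>c b\<bar> \<le> r) \<and> x = (\<Sum>b\<in>A. c b *\<^sub>R b)}"
  have "compact ((\<lambda>t. t *\<^sub>R b) ` {-r..r})"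
    by (intro compact_continuous_image continuous_intros) auto
  then have "compact {x + y |x y. x \<in> (\<lambda>t. t *\<^sub>R b) ` {-r..r} \<and> y \<in> ?S A}"
    using insert.IH by (rule compact_sums)
  moreover have "{x + y |x y. x \<in> (\<lambda>t. t *\<^sub>R b) ` {-r..r} \<and> y \<in> ?S A} = ?S (insert b A)"
  proof (intro equalityI subsetI)
    fix z assume "z \<in> {x + y |x y. x \<in> (\<lambda>t. t *\<^sub>R b) ` {-r..r} \<and> y \<in> ?S A}"
    then obtain t c where t: "t \<in> {-r..r}" and c: "\<forall>b\<in>A. \<bar>c b\<bar> \<le> r"
      and z: "z = t *\<^sub>R b + (\<Sum>b\<in>A. c b *\<^sub>R b)"
      by auto
    show "z \<in> ?S (insert b A)"
      unfolding z mem_Collect_eq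
    proof (intro exI[of _ "c(b := t)"] conjI)
      have "(\<Sum>a\<in>A. (c(b := t)) a *\<^sub>R a) = (\<Sum>a\<in>A. c a *\<^sub>R a)"
        using insert.hyps by (intro sum.cong) auto
      then show "t *\<^sub>R b + (\<Sum>b\<in>A. c b *\<^sub>R b) = (\<Sum>a\<in>insert b A. (c(b := t)) a *\<^sub>R a)"
        using insert.hyps by simp
    qed (use t c in auto)
  next
    fix z assume "z \<in> ?S (insert b A)"
    then obtain c where c: "\<forall>b\<in>insert b A. \<bar>c b\<bar> \<le> r" and z: "z = (\<Sum>b\<in>insert b A. c b *\<^sub>R b)"
      by auto
    then show "z \<in> {x + y |x y. x \<in> (\<lambda>t. t *\<^sub>R b) ` {-r..r} \<and> y \<in> ?S A}"
      using insert.hyps unfolding mem_Collect_eq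
      by (intro exI[of _ "c b *\<^sub>R b"] exI[of _ "\<Sum>b\<in>A. c b *\<^sub>R b"]) (auto simp: abs_le_iff)
  qed
  ultimately show ?case by simp
qed auto

text \<open>The usual compactness argument for equivalence of norms: \<open>S\<close> is the unit
  sphere of the maximum norm of the coordinates, a union of compact faces that avoids 0 by
  independence. Its distance from 0 gives the constant, and dividing x by its largest coordinate
  moves it to \<open>S\<close>.\<close>

lemma coord_bounded: "\<exists>K > 0. \<forall>x. \<forall>b\<in>B. \<bar>coord b x\<bar> \<le> K * norm x"
proof -
  let ?box = "\<lambda>A. {x :: 'a. \<exists>c. (\<forall>b\<in>A. \<bar>c b\<bar> \<le> 1) \<and> x = (\<Sum>b\<in>A. c b *\<^sub>R b)}"
  define S where "S = (\<Union>b\<in>B. (+) b ` ?box (B - {b}) \<union> (+) (- b) ` ?box (B - {b}))"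
  have "compact S"
    unfolding S_def using finite_basis
    by (intro compact_UN compact_Un compact_translation compact_coefficient_box) auto
  then have "open (- S)"
    using compact_imp_closed by blast
  have nonzero: "s * 1 \<noteq> (0::real) \<Longrightarrow> s *\<^sub>R b + (\<Sum>a\<in>B-{b}. c a *\<^sub>R a) \<noteq> 0" if "b \<in> B" for b s c
  proof
    assume s: "s * 1 \<noteq> 0" and "s *\<^sub>R b + (\<Sum>a\<in>B-{b}. c a *\<^sub>R a) = 0"
    moreover have "(\<Sum>a\<in>B. (c(b := s)) a *\<^sub>R a) = s *\<^sub>R b + (\<Sum>a\<in>B-{b}. c a *\<^sub>R a)"
      using that finite_basis by (subst sum.remove[of _ b]) auto
    ultimately have "coord b 0 = s"
      using coord_sum[OF that, of "c(b := s)"] by simp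
    then show False using s by simp
  qed
  have "0 \<notin> S"
  proof
    assume "0 \<in> S"
    then obtain b c where b: "b \<in> B" and "0 = b + (\<Sum>a\<in>B-{b}. c a *\<^sub>R a) \<or> 0 = - b + (\<Sum>a\<in>B-{b}. c a *\<^sub>R a)"
      unfolding S_def by blast
    then show False
      using nonzero[OF b, of 1 c] nonzero[OF b, of "-1" c] by auto
  qed
  then obtain d where d: "d > 0" "ball 0 d \<subseteq> - S"
    using \<open>open (- S)\<close> open_contains_ball by (metis ComplI)
  have "\<bar>coord b x\<bar> \<le> (1 / d) * norm x" if b: "b \<in> B" for b x
  proof (cases "x = 0")
    case False
    define M where "M = Max ((\<lambda>b. \<bar>coord b x\<bar>) ` B)"
    have le_M: "\<bar>coord a x\<bar> \<le> M" if "a \<in> B" for a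
      unfolding M_def using that finite_basis by auto
    have "M \<in> (\<lambda>b. \<bar>coord b x\<bar>) ` B"
      unfolding M_def using b finite_basis by (intro Max_in) auto
    then obtain a where a: "a \<in> B" "M = \<bar>coord a x\<bar>" by auto
    have "M \<noteq> 0"
      using coord_eqI[of x 0] False le_M by force
    then have "M > 0" using a by auto
    have "x /\<^sub>R M \<in> S"
    proof -
      let ?y = "\<Sum>c\<in>B-{a}. (coord c x / M) *\<^sub>R c"
      have eq: "x /\<^sub>R M = (coord a x / M) *\<^sub>R a + ?y"
        using sum_coord[of "x /\<^sub>R M"] a finite_basis
        by (subst sum_coord[of "x /\<^sub>R M", symmetric], subst sum.remove[of _ a])
          (auto simp: divide_inverse mult.commute)
      have y: "?y \<in> ?box (B - {a})"
        using le_M \<open>M > 0\<close> by (auto intro!: exI[of _ "\<lambda>c. coord c x / M"])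
      have "coord a x / M = 1 \<or> coord a x / M = -1"
        using a(2) \<open>M > 0\<close> by (auto simp: field_simps abs_if split: if_splits)
      then show ?thesis
      proof
        assume "coord a x / M = 1"
        then have "x /\<^sub>R M \<in> (+) a ` ?box (B - {a})"
          unfolding eq using y by (intro image_eqI[of _ _ ?y]) simp_all
        then show ?thesis
          unfolding S_def using a(1) by blast
      next
        assume "coord a x / M = - 1"
        then have "x /\<^sub>R M \<in> (+) (- a) ` ?box (B - {a})"
          unfolding eq using y by (intro image_eqI[of _ _ ?y]) simp_all
        then show ?thesis
          unfolding S_def using a(1) by blast
      qed
    qed
    then have "norm (x /\<^sub>R M) \<ge> d"
      using d(2) by (force simp: subset_eq not_less)
    then have "M \<le> norm x / d"
      using d(1) \<open>M > 0\<close> by (simp add: field_simps)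
    then show ?thesis using le_M[OF b] by simp
  qed auto
  then show ?thesis using d(1) by (intro exI[of _ "1 / d"]) auto
qed

lemma bounded_linear_functional:
  fixes l :: "'a \<Rightarrow> real"
  assumes "linear l"
  shows "bounded_linear l"
proof -
  obtain K where K: "\<And>x b. b \<in> B \<Longrightarrow> \<bar>coord b x\<bar> \<le> K * norm x"
    using coord_bounded by blast
  have "norm (l x) \<le> norm x * (K * (\<Sum>b\<in>B. \<bar>l b\<bar>))" for x
  proof -
    have "norm (l x) \<le> (\<Sum>b\<in>B. \<bar>coord b x * l b\<bar>)"
      unfolding linear_coord_expansion[OF assms, of x] by (simp add: sum_abs)
    also have "\<dots> \<le> (\<Sum>b\<in>B. K * norm x * \<bar>l b\<bar>)"
      by (intro sum_mono) (auto simp: abs_mult intro!: mult_right_mono K)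
    finally show ?thesis by (simp add: sum_distrib_left mult_ac)
  qed
  then show ?thesis
    using assms by (intro bounded_linear_intro[of l "K * (\<Sum>b\<in>B. \<bar>l b\<bar>)"])
      (auto simp: linear_add linear_scale)
qed

lemma continuous_on_linear_functional:
  "linear l \<Longrightarrow> continuous_on S l" for l :: "'a \<Rightarrow> real"
  by (rule linear_continuous_on[OF bounded_linear_functional])

lemma compact_coord_box: "compact {x. \<forall>b\<in>B. \<bar>coord b x - coord b a\<bar> \<le> r}"
proof -
  have "{x. \<forall>b\<in>B. \<bar>coord b x - coord b a\<bar> \<le> r} =
      (+) a ` {x. \<exists>c. (\<forall>b\<in>B. \<bar>c b\<bar> \<le> r) \<and> x = (\<Sum>b\<in>B. c b *\<^sub>R b)}" (is "?L = (+) a ` ?R")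
  proof (intro equalityI subsetI)
    fix x assume "x \<in> ?L"
    then have "x - a \<in> ?R"
      by (intro CollectI exI[of _ "\<lambda>b. coord b (x - a)"]) (simp add: sum_coord del: coord_simps, simp)
    then show "x \<in> (+) a ` ?R"
      by (rule image_eqI[rotated]) simp
  qed (auto simp: coord_sum)
  then show ?thesis
    by (simp add: compact_translation compact_coefficient_box finite_basis)
qed

lemma coord_box_subset_open:
  assumes "open U" "a \<in> U"
  shows "\<exists>r > 0. {x. \<forall>b\<in>B. \<bar>coord b x - coord b a\<bar> \<le> r} \<subseteq> U"
proof -
  obtain e where e: "e > 0" "ball a e \<subseteq> U"
    using assms open_contains_ball by blast
  \<comment> \<open>The summand 1 keeps \<open>S\<close> positive in dimension 0.\<close>
  define S where "S = 1 + (\<Sum>b\<in>B. norm b)"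
  have "S > 0"
    unfolding S_def by (simp add: add_pos_nonneg sum_nonneg)
  have "x \<in> U" if x: "\<forall>b\<in>B. \<bar>coord b x - coord b a\<bar> \<le> e / (2 * S)" for x
  proof -
    have "norm (x - a) = norm (\<Sum>b\<in>B. coord b (x - a) *\<^sub>R b)"
      by (simp only: sum_coord)
    also have "\<dots> \<le> (\<Sum>b\<in>B. e / (2 * S) * norm b)"
      using x by (intro sum_norm_le) (auto simp del: times_divide_eq_left intro!: mult_right_mono)
    also have "\<dots> = e / (2 * S) * (S - 1)"
      by (simp add: S_def sum_distrib_left)
    also have "\<dots> < e"
      using \<open>S > 0\<close> e(1) by (simp add: field_simps add_strict_increasing)
    finally show ?thesis using e(2) by (auto simp: dist_norm norm_minus_commute)
  qed
  then show ?thesis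
    using e(1) \<open>S > 0\<close> by (intro exI[of _ "e / (2 * S)"]) auto
qed

end

section \<open>Bump functions\<close>

text \<open>The polynomial is carried along to make the family closed under differentiation; the
  bump functions use only \<open>flat 1\<close>, which is exp(-1/t) for t > 0.\<close>

definition flat :: "real poly \<Rightarrow> real \<Rightarrow> real" where
  "flat p t = (if t > 0 then poly p (1 / t) * exp (- (1 / t)) else 0)"

lemma poly_times_exp_minus_tendsto_0: "((\<lambda>s. poly p s * exp (- s)) \<longlongrightarrow> 0) at_top" for p :: "real poly"
proof -
  have "((\<lambda>s. \<Sum>i\<le>degree p. coeff p i * (s ^ i / exp s)) \<longlongrightarrow> (\<Sum>i\<le>degree p. coeff p i * 0)) at_top"
    by (intro tendsto_sum tendsto_mult tendsto_const tendsto_power_div_exp_0)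
  then show ?thesis
    by (simp add: poly_altdef exp_minus sum_distrib_right divide_inverse mult.assoc)
qed

text \<open>With s = 1/t the chain rule turns p(s) exp(-s) into s^2 (p(s) - p'(s)) exp(-s), so only
  t = 0 needs an argument.\<close>

lemma flat_has_real_derivative:
  "(flat p has_real_derivative flat ([:0, 0, 1:] * (p - pderiv p)) t) (at t)"
proof -
  consider "t > 0" | "t < 0" | "t = 0" by linarith
  then show ?thesis
  proof cases
    case 1
    have "((\<lambda>t. poly p (1 / t) * exp (- (1 / t))) has_real_derivative
        flat ([:0, 0, 1:] * (p - pderiv p)) t) (at t)"
      using 1 by (auto intro!: derivative_eq_intros DERIV_chain2[OF poly_DERIV]
          simp: flat_def field_simps power2_eq_square)
    then show ?thesis
      by (rule has_field_derivative_transform_within_open[of _ _ _ "{0<..}"]) (use 1 in \<open>auto simp: flat_def\<close>)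
  next
    case 2
    have "((\<lambda>t. 0) has_real_derivative flat ([:0, 0, 1:] * (p - pderiv p)) t) (at t)"
      using 2 by (simp add: flat_def)
    then show ?thesis
      by (rule has_field_derivative_transform_within_open[of _ _ _ "{..<0}"]) (use 2 in \<open>auto simp: flat_def\<close>)
  next
    case 3
    \<comment> \<open>The difference quotient from the right is s p(s) exp(-s) with s = 1/h tending
      to infinity.\<close>
    have "((\<lambda>h. flat p h / h) \<longlongrightarrow> 0) (at_right 0)"
    proof -
      have "((\<lambda>h. poly (pCons 0 p) (inverse h) * exp (- inverse h)) \<longlongrightarrow> 0) (at_right (0::real))"
        by (rule filterlim_compose[OF poly_times_exp_minus_tendsto_0 filterlim_inverse_at_top_right])
      moreover have "\<forall>\<^sub>F h in at_right 0. poly (pCons 0 p) (inverse h) * exp (- inverse h) = flat p h / h"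
        by (auto simp: eventually_at_filter flat_def divide_inverse)
      ultimately show ?thesis
        by (rule Lim_transform_eventually)
    qed
    moreover have "((\<lambda>h. flat p h / h) \<longlongrightarrow> 0) (at_left 0)"
      by (rule tendsto_eventually) (auto simp: eventually_at_filter flat_def)
    ultimately have "((\<lambda>h. flat p h / h) \<longlongrightarrow> 0) (at 0)"
      by (simp add: filterlim_split_at_real)
    then show ?thesis
      unfolding 3 DERIV_def by (simp add: flat_def)
  qed
qed

text \<open>An algebra of functions stable under directional derivatives: smoothness in the sense of
  \<open>dir_deriv\<close> then follows by one induction on the list of directions.\<close>

inductive flat_algebra :: "('a::real_normed_vector \<Rightarrow> complex) \<Rightarrow> bool" where
  const: "flat_algebra (\<lambda>x. c)"
| flat: "bounded_linear l \<Longrightarrow> flat_algebra (\<lambda>x. of_real (flat p (l x + c)))"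
| add: "flat_algebra f \<Longrightarrow> flat_algebra g \<Longrightarrow> flat_algebra (\<lambda>x. f x + g x)"
| mult: "flat_algebra f \<Longrightarrow> flat_algebra g \<Longrightarrow> flat_algebra (\<lambda>x. f x * g x)"

lemma flat_algebra_has_derivative:
  assumes "flat_algebra f"
  shows "\<exists>f'. (\<forall>x. (f has_derivative f' x) (at x)) \<and> (\<forall>v. flat_algebra (\<lambda>x. f' x v))"
  using assms
proof induction
  case (const c)
  show ?case
    by (rule exI[of _ "\<lambda>_ _. 0"]) (auto intro: flat_algebra.const)
next
  case (flat l p c)
  let ?q = "[:0, 0, 1:] * (p - pderiv p)"
  have "((\<lambda>x. of_real (flat p (l x + c)) :: complex) has_derivative
      (\<lambda>v. of_real (l v) * of_real (flat ?q (l x + c)))) (at x)" for x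
  proof -
    have "((\<lambda>x. l x + c) has_derivative l) (at x)"
      using bounded_linear_imp_has_derivative[OF flat] by (auto intro!: derivative_eq_intros)
    then have "((\<lambda>x. flat p (l x + c)) has_derivative (\<lambda>v. flat ?q (l x + c) * l v)) (at x)"
      using has_derivative_compose[OF _ flat_has_real_derivative[unfolded has_field_derivative_def]] by blast
    then have "((\<lambda>x. of_real (flat p (l x + c)) :: complex) has_derivative
        (\<lambda>v. of_real (flat ?q (l x + c) * l v))) (at x)"
      by (rule bounded_linear.has_derivative[OF bounded_linear_of_real])
    then show ?thesis by (simp add: mult.commute)
  qed
  then show ?case
    using flat by (intro exI[of _ "\<lambda>x v. of_real (l v) * of_real (flat ?q (l x + c))"] conjI allI
        flat_algebra.mult flat_algebra.const flat_algebra.flat)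
next
  case (add f g)
  then obtain f' g' where
    "\<And>x. (f has_derivative f' x) (at x)" "\<And>v. flat_algebra (\<lambda>x. f' x v)"
    "\<And>x. (g has_derivative g' x) (at x)" "\<And>v. flat_algebra (\<lambda>x. g' x v)"
    by blast
  then show ?case
    by (intro exI[of _ "\<lambda>x v. f' x v + g' x v"]) (auto intro!: derivative_eq_intros flat_algebra.add)
next
  case (mult f g)
  then obtain f' g' where
    "\<And>x. (f has_derivative f' x) (at x)" "\<And>v. flat_algebra (\<lambda>x. f' x v)"
    "\<And>x. (g has_derivative g' x) (at x)" "\<And>v. flat_algebra (\<lambda>x. g' x v)"
    by blast
  with mult.hyps show ?case
    by (intro exI[of _ "\<lambda>x v. f x * g' x v + f' x v * g x"])
      (auto intro!: derivative_eq_intros flat_algebra.add flat_algebra.mult)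
qed

lemma smooth_flat_algebra:
  assumes "flat_algebra f"
  shows "smooth f"
proof -
  have deriv: "flat_algebra (\<lambda>x. frechet_derivative h (at x) v) \<and> h differentiable (at x)"
    if h: "flat_algebra h" for h v x
  proof -
    obtain h' where h': "\<And>x. (h has_derivative h' x) (at x)" "\<And>v. flat_algebra (\<lambda>x. h' x v)"
      using flat_algebra_has_derivative[OF h] by blast
    then show ?thesis
      using frechet_derivative_at[OF h'(1)] by (auto simp: differentiable_def)
  qed
  have "flat_algebra (dir_deriv vs f)" for vs
    by (induction vs) (use assms deriv in auto)
  then show ?thesis
    unfolding smooth_def using deriv by blast
qed

lemma flat_algebra_prod:
  "finite A \<Longrightarrow> (\<And>a. a \<in> A \<Longrightarrow> flat_algebra (f a)) \<Longrightarrow> flat_algebra (\<lambda>x. \<Prod>a\<in>A. f a x)"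
  by (induction A rule: finite_induct) (auto intro: flat_algebra.intros)

section \<open>Bump functions in lattice coordinates\<close>

context lattice_basis
begin

text \<open>Both factors for b are nonzero exactly when the b-th coordinates of x and a differ by
  less than r. In dimension 0 the empty product is the constant 1.\<close>

definition bump :: "'a \<Rightarrow> real \<Rightarrow> 'a \<Rightarrow> real" where
  "bump a r x = (\<Prod>b\<in>B. flat 1 (r - (coord b x - coord b a)) * flat 1 (r + (coord b x - coord b a)))"

lemma bump_nonneg: "bump a r x \<ge> 0"
  by (auto simp: bump_def flat_def intro!: prod_nonneg)

lemma bump_pos: "r > 0 \<Longrightarrow> bump a r a > 0"
  by (auto simp: bump_def flat_def intro!: prod_pos)

lemma bump_nonzeroD:
  assumes "bump a r x \<noteq> 0"
  shows "\<forall>b\<in>B. \<bar>coord b x - coord b a\<bar> \<le> r"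
proof
  fix b assume "b \<in> B"
  then have "flat 1 (r - (coord b x - coord b a)) \<noteq> 0" "flat 1 (r + (coord b x - coord b a)) \<noteq> 0"
    using assms finite_basis by (auto simp: bump_def)
  then show "\<bar>coord b x - coord b a\<bar> \<le> r"
    by (auto simp: flat_def split: if_splits)
qed

lemma test_function_bump: "test_function (\<lambda>x. of_real (bump a r x))"
proof -
  have aff: "bounded_linear (coord b)" "bounded_linear (\<lambda>x. - coord b x)" for b
    using bounded_linear_functional[OF linear_coord] by (auto intro: bounded_linear_minus)
  have "flat_algebra (\<lambda>x. \<Prod>b\<in>B. of_real (flat 1 (- coord b x + (r + coord b a))) *
      of_real (flat 1 (coord b x + (r - coord b a))))"
    by (intro flat_algebra_prod flat_algebra.mult flat_algebra.flat aff finite_basis)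
  then have "smooth (\<lambda>x. of_real (bump a r x))"
    by (intro smooth_flat_algebra) (simp add: bump_def algebra_simps)
  moreover have "compact (supp (\<lambda>x. of_real (bump a r x) :: complex))"
  proof -
    let ?K = "{x. \<forall>b\<in>B. \<bar>coord b x - coord b a\<bar> \<le> r}"
    have "{x. (of_real (bump a r x) :: complex) \<noteq> 0} \<subseteq> ?K"
      using bump_nonzeroD by auto
    then have "supp (\<lambda>x. of_real (bump a r x) :: complex) \<subseteq> ?K"
      unfolding supp_def by (intro closure_minimal compact_imp_closed compact_coord_box)
    moreover have "compact (?K \<inter> supp (\<lambda>x. of_real (bump a r x) :: complex))"
      by (intro compact_Int_closed compact_coord_box) (simp add: supp_def)
    ultimately show ?thesis
      by (simp add: Int_absorb1)
  qed
  ultimately show ?thesis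
    by (simp add: test_function_def)
qed

text \<open>The coordinates of such \<mu> are integers of absolute value at most k M. This turns the
  infinite sum in \<open>Theta\<close> into a finite one.\<close>

lemma finite_bump_support:
  assumes "k \<ge> 1"
  shows "finite {\<mu> \<in> \<Lambda>. bump a r (\<mu> /\<^sub>R real k) \<noteq> 0}"
proof -
  define M where "M = Max ((\<lambda>b. \<bar>coord b a\<bar> + r) ` B)"
  have M: "\<bar>coord b a\<bar> + r \<le> M" if "b \<in> B" for b
    unfolding M_def using that finite_basis by (intro Max_ge) auto
  let ?I = "{z::real. z \<in> \<int> \<and> \<bar>z\<bar> \<le> real k * M}"
  have "finite ?I"
    by (rule finite_abs_int_segment)
  have "{\<mu> \<in> \<Lambda>. bump a r (\<mu> /\<^sub>R real k) \<noteq> 0} \<subseteq> (\<lambda>c. \<Sum>b\<in>B. c b *\<^sub>R b) ` PiE B (\<lambda>_. ?I)"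
  proof
    fix \<mu> assume "\<mu> \<in> {\<mu> \<in> \<Lambda>. bump a r (\<mu> /\<^sub>R real k) \<noteq> 0}"
    then have \<mu>: "\<mu> \<in> \<Lambda>" and box: "\<And>b. b \<in> B \<Longrightarrow> \<bar>coord b \<mu> / real k - coord b a\<bar> \<le> r"
      using bump_nonzeroD[of a r "\<mu> /\<^sub>R real k"] by (auto simp: divide_inverse mult.commute)
    have "\<bar>coord b \<mu>\<bar> \<le> real k * M" if "b \<in> B" for b
    proof -
      have "\<bar>coord b \<mu> / real k\<bar> \<le> M"
        using box[OF that] M[OF that] by linarith
      then show ?thesis using assms by (simp add: field_simps abs_divide)
    qed
    then have "restrict (\<lambda>b. coord b \<mu>) B \<in> PiE B (\<lambda>_. ?I)"
      using \<mu> by (auto simp: mem_lattice_iff)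
    moreover have "\<mu> = (\<Sum>b\<in>B. restrict (\<lambda>b. coord b \<mu>) B b *\<^sub>R b)"
      by (simp add: sum_coord)
    ultimately show "\<mu> \<in> (\<lambda>c. \<Sum>b\<in>B. c b *\<^sub>R b) ` PiE B (\<lambda>_. ?I)"
      by (intro image_eqI)
  qed
  then show ?thesis
    using \<open>finite ?I\<close> finite_basis by (meson finite_PiE finite_imageI finite_subset)
qed

end

section \<open>The Euler relation for compact convex sets\<close>

text \<open>Moving from s slightly to the right loses exactly the intervals that end at s and gains
  none, so the coefficients with right end s sum to 0. Every interval has exactly one right
  end.\<close>

lemma sum_eq_0_if_interval_sum_eq_0:
  fixes a :: "'i \<Rightarrow> complex" and u v :: "'i \<Rightarrow> real"
  assumes "finite I" and le: "\<And>i. i \<in> I \<Longrightarrow> u i \<le> v i"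
    and zero: "\<And>t. (\<Sum>i\<in>I. if u i \<le> t \<and> t \<le> v i then a i else 0) = 0"
  shows "(\<Sum>i\<in>I. a i) = 0"
proof -
  have "(\<Sum>i\<in>{i \<in> I. v i = s}. a i) = 0" for s
  proof -
    \<comment> \<open>A point t > s is wanted with no endpoint of any interval in (s, t].\<close>
    have "\<forall>\<^sub>F t in at_right s. x > s \<longrightarrow> t < x" for x
      by (cases "x > s") (auto simp: eventually_at_right_field)
    then have "\<forall>\<^sub>F t in at_right s. t > s \<and> (\<forall>x\<in>u ` I \<union> v ` I. x > s \<longrightarrow> t < x)"
      using \<open>finite I\<close> by (intro eventually_conj eventually_ball_finite eventually_at_right_less) auto
    then obtain t where t: "t > s" and gap: "\<And>i. i \<in> I \<Longrightarrow> u i > s \<longrightarrow> t < u i"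
        "\<And>i. i \<in> I \<Longrightarrow> v i > s \<longrightarrow> t < v i"
      using eventually_happens[of _ "at_right s"] trivial_limit_at_right_real by blast
    have "0 = (\<Sum>i\<in>I. (if u i \<le> s \<and> s \<le> v i then a i else 0) - (if u i \<le> t \<and> t \<le> v i then a i else 0))"
      by (simp add: sum_subtractf zero)
    also have "\<dots> = (\<Sum>i\<in>I. if v i = s then a i else 0)"
    proof (intro sum.cong refl)
      fix i assume "i \<in> I"
      then show "(if u i \<le> s \<and> s \<le> v i then a i else 0) - (if u i \<le> t \<and> t \<le> v i then a i else 0) =
          (if v i = s then a i else 0)"
        using gap[of i] t le[of i] by (auto split: if_splits)
    qed
    finally show ?thesis
      using \<open>finite I\<close> by (simp add: sum.If_cases Int_def)
  qed
  then show ?thesis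
    using sum.image_gen[OF \<open>finite I\<close>, of a v] by simp
qed

text \<open>Induction on the functionals that separate points. Slices by a level set of l are
  separated by the others, and the slice of K i at t is nonempty iff t lies in the compact interval
  l(K i); the relations for slices are therefore the hypothesis of the one-dimensional case.
  Separation is required only on the union of the K i, a condition inherited by slices.\<close>

lemma euler_relation_compact_convex:
  fixes K :: "'i \<Rightarrow> 'a::real_normed_vector set" and a :: "'i \<Rightarrow> complex"
  assumes "finite Ls" and "\<And>l. l \<in> Ls \<Longrightarrow> linear l \<and> continuous_on UNIV (l :: 'a \<Rightarrow> real)"
    and "finite I" and "\<And>i. i \<in> I \<Longrightarrow> compact (K i) \<and> convex (K i)"
    and "\<And>x y. x \<in> (\<Union>i\<in>I. K i) \<Longrightarrow> y \<in> (\<Union>i\<in>I. K i) \<Longrightarrow> (\<forall>l\<in>Ls. l x = l y) \<Longrightarrow> x = y"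
    and "\<And>x. (\<Sum>i\<in>I. if x \<in> K i then a i else 0) = 0"
  shows "(\<Sum>i\<in>I. if K i \<noteq> {} then a i else 0) = 0"
  using assms
proof (induction Ls arbitrary: K)
  case empty
  show ?case
  proof (cases "\<forall>i\<in>I. K i = {}")
    case False
    \<comment> \<open>With no functionals left the union is a single point, so a nonempty K i is one
      that contains x.\<close>
    then obtain x where x: "x \<in> (\<Union>i\<in>I. K i)"
      by blast
    have "K i \<noteq> {} \<longleftrightarrow> x \<in> K i" if "i \<in> I" for i
      using empty.prems(4)[OF x] that by blast
    then show ?thesis
      using empty.prems(5)[of x] by (simp cong: sum.cong)
  qed simp
next
  case (insert l Ls)
  have l: "linear l" "continuous_on UNIV l"
    using insert.prems(1) by auto
  have slices: "(\<Sum>i\<in>I. if K i \<inter> l -` {t} \<noteq> {} then a i else 0) = 0" for t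
  proof (rule insert.IH)
    fix i assume "i \<in> I"
    then show "compact (K i \<inter> l -` {t}) \<and> convex (K i \<inter> l -` {t})"
      using insert.prems(3) l
      by (intro conjI compact_Int_closed convex_Int convex_linear_vimage closed_vimage) auto
  next
    fix x
    have "(\<Sum>i\<in>I. if x \<in> K i \<inter> l -` {t} then a i else 0) =
        (if l x = t then \<Sum>i\<in>I. if x \<in> K i then a i else 0 else 0)"
      by (auto intro!: sum.cong sum.neutral)
    then show "(\<Sum>i\<in>I. if x \<in> K i \<inter> l -` {t} then a i else 0) = 0"
      using insert.prems(5) by simp
  next
    fix x y
    assume "x \<in> (\<Union>i\<in>I. K i \<inter> l -` {t})" "y \<in> (\<Union>i\<in>I. K i \<inter> l -` {t})" "\<forall>l\<in>Ls. l x = l y"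
    then show "x = y"
      by (intro insert.prems(4)) auto
  qed (use insert.prems in auto)
  define I' where "I' = {i \<in> I. K i \<noteq> {}}"
  have "\<exists>u v. l ` K i = {u..v}" if "i \<in> I'" for i
  proof -
    have "compact (l ` K i)"
      using that insert.prems(3) l(2) unfolding I'_def
      by (intro compact_continuous_image) (auto intro: continuous_on_subset)
    moreover have "connected (l ` K i)"
      using that insert.prems(3) l(1) unfolding I'_def
      by (intro convex_connected convex_linear_image) auto
    ultimately show ?thesis
      using connected_compact_interval_1 by blast
  qed
  then obtain u v where uv: "\<And>i. i \<in> I' \<Longrightarrow> l ` K i = {u i..v i}"
    by metis
  have "(\<Sum>i\<in>I'. a i) = 0"
  proof (rule sum_eq_0_if_interval_sum_eq_0[where u = u and v = v])
    fix t
    have "(\<Sum>i\<in>I'. if u i \<le> t \<and> t \<le> v i then a i else 0) = (\<Sum>i\<in>I'. if K i \<inter> l -` {t} \<noteq> {} then a i else 0)"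
    proof (intro sum.cong refl)
      fix i assume "i \<in> I'"
      have "u i \<le> t \<and> t \<le> v i \<longleftrightarrow> t \<in> l ` K i"
        using uv[OF \<open>i \<in> I'\<close>] by simp
      also have "\<dots> \<longleftrightarrow> K i \<inter> l -` {t} \<noteq> {}"
        by blast
      finally show "(if u i \<le> t \<and> t \<le> v i then a i else 0) = (if K i \<inter> l -` {t} \<noteq> {} then a i else 0)"
        by simp
    qed
    also have "\<dots> = (\<Sum>i\<in>I. if K i \<inter> l -` {t} \<noteq> {} then a i else 0)"
      unfolding I'_def using \<open>finite I\<close> by (intro sum.mono_neutral_left) auto
    finally show "(\<Sum>i\<in>I'. if u i \<le> t \<and> t \<le> v i then a i else 0) = 0"
      using slices by simp
  next
    fix i assume "i \<in> I'"
    then have "l ` K i \<noteq> {}"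
      by (simp add: I'_def)
    then show "u i \<le> v i"
      using uv[OF \<open>i \<in> I'\<close>] by simp
  qed (use \<open>finite I\<close> in \<open>simp add: I'_def\<close>)
  then show ?case
    using \<open>finite I\<close> by (simp add: I'_def sum.If_cases Int_def)
qed

section \<open>Quasi-polynomial functions along rays\<close>

lemma cone_over_pos: "t > 0 \<Longrightarrow> (x, t) \<in> cone_over P \<longleftrightarrow> x /\<^sub>R t \<in> P"
  by (force simp: cone_over_def)

lemma cone_over_zero: "(x, 0) \<in> cone_over P \<longleftrightarrow> x = 0 \<and> P \<noteq> {}"
  by (auto simp: cone_over_def)

lemma cone_over_neg: "t < 0 \<Longrightarrow> (x, t) \<notin> cone_over P"
  by (auto simp: cone_over_def)

lemma quasi_polynomial_const: "quasi_polynomial L (\<lambda>_. c)"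
  by (rule quasi_polynomial.polynomial) simp

lemma quasi_polynomial_sum:
  "finite I \<Longrightarrow> (\<And>i. i \<in> I \<Longrightarrow> quasi_polynomial L (q i)) \<Longrightarrow> quasi_polynomial L (\<lambda>x. \<Sum>i\<in>I. q i x)"
  by (induction I rule: finite_induct) (auto intro: quasi_polynomial_const quasi_polynomial.add)

text \<open>Meant for expansions q(t z) = P z (t) along rays. Continuity in z transfers estimates
  from a point to a neighbourhood; the uniform degree bound guarantees a largest relevant
  power.\<close>

definition poly_family :: "('w::real_normed_vector \<Rightarrow> complex poly) \<Rightarrow> bool" where
  "poly_family P \<longleftrightarrow> (\<forall>j. continuous_on UNIV (\<lambda>z. coeff (P z) j)) \<and> (\<exists>n. \<forall>z. degree (P z) \<le> n)"

lemma poly_family_const: "poly_family (\<lambda>_. p)"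
  by (auto simp: poly_family_def)

lemma poly_family_add:
  assumes "poly_family P" "poly_family Q"
  shows "poly_family (\<lambda>z. P z + Q z)"
proof -
  obtain n m where "\<And>z. degree (P z) \<le> n" "\<And>z. degree (Q z) \<le> m"
    using assms by (auto simp: poly_family_def)
  then have "degree (P z + Q z) \<le> max n m" for z
    by (intro degree_add_le) (auto simp: le_max_iff_disj)
  then show ?thesis
    using assms by (auto simp: poly_family_def intro!: continuous_intros)
qed

lemma poly_family_mult:
  assumes "poly_family P" "poly_family Q"
  shows "poly_family (\<lambda>z. P z * Q z)"
proof -
  obtain n m where "\<And>z. degree (P z) \<le> n" "\<And>z. degree (Q z) \<le> m"
    using assms by (auto simp: poly_family_def)
  then have "degree (P z * Q z) \<le> n + m" for z
    by (meson add_mono degree_mult_le order_trans)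
  then show ?thesis
    using assms by (auto simp: poly_family_def coeff_mult intro!: continuous_intros)
qed

lemma real_polynomial_function_expansion:
  assumes "real_polynomial_function f"
  shows "\<exists>P. poly_family P \<and> (\<forall>t z. of_real (f (t *\<^sub>R z)) = poly (P z) (of_real t))"
  using assms
proof induction
  case (linear f)
  have "poly_family (\<lambda>z. [:0, complex_of_real (f z):])"
    unfolding poly_family_def
  proof (intro conjI allI exI[of _ 1])
    show "continuous_on UNIV (\<lambda>z. coeff [:0, complex_of_real (f z):] j)" for j
      using linear_continuous_on[OF linear]
      by (cases j; cases "j - 1") (auto intro!: continuous_intros)
  qed auto
  then show ?case
    using linear_scale[OF bounded_linear.linear[OF linear]]
    by (intro exI[of _ "\<lambda>z. [:0, complex_of_real (f z):]"]) auto
next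
  case (const c)
  show ?case
    using poly_family_const[of "[:complex_of_real c:]"]
    by (intro exI[of _ "\<lambda>z. [:complex_of_real c:]"]) auto
next
  case (add f g)
  then obtain P Q where "poly_family P" "\<And>t z. of_real (f (t *\<^sub>R z)) = poly (P z) (of_real t)"
    "poly_family Q" "\<And>t z. of_real (g (t *\<^sub>R z)) = poly (Q z) (of_real t)"
    by blast
  then show ?case
    by (intro exI[of _ "\<lambda>z. P z + Q z"]) (simp add: poly_family_add)
next
  case (mult f g)
  then obtain P Q where "poly_family P" "\<And>t z. of_real (f (t *\<^sub>R z)) = poly (P z) (of_real t)"
    "poly_family Q" "\<And>t z. of_real (g (t *\<^sub>R z)) = poly (Q z) (of_real t)"
    by blast
  then show ?case
    by (intro exI[of _ "\<lambda>z. P z * Q z"]) (simp add: poly_family_mult)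
qed

lemma polynomial_function_expansion:
  fixes p :: "'w::real_normed_vector \<Rightarrow> complex"
  assumes "polynomial_function p"
  shows "\<exists>P. poly_family P \<and> (\<forall>t z. p (t *\<^sub>R z) = poly (P z) (of_real t))"
proof -
  have "real_polynomial_function (\<lambda>z. Re (p z))" "real_polynomial_function (\<lambda>z. Im (p z))"
    using assms bounded_linear_Re bounded_linear_Im by (auto simp: polynomial_function_def o_def)
  then obtain P Q where P: "poly_family P" "\<And>t z. of_real (Re (p (t *\<^sub>R z))) = poly (P z) (of_real t)"
    and Q: "poly_family Q" "\<And>t z. of_real (Im (p (t *\<^sub>R z))) = poly (Q z) (of_real t)"
    using real_polynomial_function_expansion by metis
  show ?thesis
  proof (intro exI conjI allI)
    show "poly_family (\<lambda>z. P z + [:\<i>:] * Q z)"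
      by (intro poly_family_add poly_family_mult poly_family_const P Q)
    show "p (t *\<^sub>R z) = poly (P z + [:\<i>:] * Q z) (of_real t)" for t z
      using P(2)[of t z] Q(2)[of t z] complex_eq[of "p (t *\<^sub>R z)"] by simp
  qed
qed

text \<open>One family serves a whole coset and every way of writing its points as t z. With t = k
  and z = (\<xi>, 1) it expands in powers of k with coefficients depending on \<xi>; with t = 0 it
  reaches the origin.\<close>

definition coset_expansion :: "'w::real_normed_vector set \<Rightarrow> ('w \<Rightarrow> complex) \<Rightarrow> nat \<Rightarrow> bool" where
  "coset_expansion L q D \<longleftrightarrow> D > 0 \<and> (\<forall>x\<in>L. \<exists>P. poly_family P \<and>
     (\<forall>y\<in>L. \<forall>t z. x + real D *\<^sub>R y = t *\<^sub>R z \<longrightarrow> q (x + real D *\<^sub>R y) = poly (P z) (of_real t)))"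

text \<open>Cosets modulo D E refine cosets modulo D, so two functions can be given a common
  modulus.\<close>

lemma coset_expansion_multiple:
  assumes L: "\<And>n x. x \<in> L \<Longrightarrow> real n *\<^sub>R x \<in> L" and "coset_expansion L q D" "E > 0"
  shows "coset_expansion L q (D * E)"
  unfolding coset_expansion_def
proof (intro conjI ballI)
  fix x assume "x \<in> L"
  then obtain P where P: "poly_family P"
    and eq: "\<And>y t z. y \<in> L \<Longrightarrow> x + real D *\<^sub>R y = t *\<^sub>R z \<Longrightarrow> q (x + real D *\<^sub>R y) = poly (P z) (of_real t)"
    using assms(2) unfolding coset_expansion_def by blast
  show "\<exists>P. poly_family P \<and> (\<forall>y\<in>L. \<forall>t z. x + real (D * E) *\<^sub>R y = t *\<^sub>R z \<longrightarrow>
      q (x + real (D * E) *\<^sub>R y) = poly (P z) (of_real t))"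
  proof (intro exI[of _ P] conjI ballI allI impI P)
    fix y t z assume "y \<in> L" "x + real (D * E) *\<^sub>R y = t *\<^sub>R z"
    then show "q (x + real (D * E) *\<^sub>R y) = poly (P z) (of_real t)"
      using eq[OF L[of y E]] by simp
  qed
qed (use assms in \<open>auto simp: coset_expansion_def\<close>)

lemma coset_expansion_mult:
  assumes f: "coset_expansion L f D" and g: "coset_expansion L g D"
  shows "coset_expansion L (\<lambda>x. f x * g x) D"
  unfolding coset_expansion_def
proof (intro conjI ballI)
  fix x assume "x \<in> L"
  obtain P where P: "poly_family P"
    "\<And>y t z. y \<in> L \<Longrightarrow> x + real D *\<^sub>R y = t *\<^sub>R z \<Longrightarrow> f (x + real D *\<^sub>R y) = poly (P z) (of_real t)"
    using f \<open>x \<in> L\<close> unfolding coset_expansion_def by blast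
  obtain Q where Q: "poly_family Q"
    "\<And>y t z. y \<in> L \<Longrightarrow> x + real D *\<^sub>R y = t *\<^sub>R z \<Longrightarrow> g (x + real D *\<^sub>R y) = poly (Q z) (of_real t)"
    using g \<open>x \<in> L\<close> unfolding coset_expansion_def by blast
  show "\<exists>P. poly_family P \<and> (\<forall>y\<in>L. \<forall>t z. x + real D *\<^sub>R y = t *\<^sub>R z \<longrightarrow>
      f (x + real D *\<^sub>R y) * g (x + real D *\<^sub>R y) = poly (P z) (of_real t))"
    by (intro exI[of _ "\<lambda>z. P z * Q z"] conjI ballI allI impI poly_family_mult P Q)
      (metis P(2) Q(2) poly_mult)
qed (use f in \<open>simp add: coset_expansion_def\<close>)

lemma coset_expansion_add:
  assumes f: "coset_expansion L f D" and g: "coset_expansion L g D"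
  shows "coset_expansion L (\<lambda>x. f x + g x) D"
  unfolding coset_expansion_def
proof (intro conjI ballI)
  fix x assume "x \<in> L"
  obtain P where P: "poly_family P"
    "\<And>y t z. y \<in> L \<Longrightarrow> x + real D *\<^sub>R y = t *\<^sub>R z \<Longrightarrow> f (x + real D *\<^sub>R y) = poly (P z) (of_real t)"
    using f \<open>x \<in> L\<close> unfolding coset_expansion_def by blast
  obtain Q where Q: "poly_family Q"
    "\<And>y t z. y \<in> L \<Longrightarrow> x + real D *\<^sub>R y = t *\<^sub>R z \<Longrightarrow> g (x + real D *\<^sub>R y) = poly (Q z) (of_real t)"
    using g \<open>x \<in> L\<close> unfolding coset_expansion_def by blast
  show "\<exists>P. poly_family P \<and> (\<forall>y\<in>L. \<forall>t z. x + real D *\<^sub>R y = t *\<^sub>R z \<longrightarrow>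
      f (x + real D *\<^sub>R y) + g (x + real D *\<^sub>R y) = poly (P z) (of_real t))"
    by (intro exI[of _ "\<lambda>z. P z + Q z"] conjI ballI allI impI poly_family_add P Q)
      (metis P(2) Q(2) poly_add)
qed (use f in \<open>simp add: coset_expansion_def\<close>)

lemma quasi_polynomial_coset_expansion:
  assumes L: "\<And>n x. x \<in> L \<Longrightarrow> real n *\<^sub>R x \<in> L" and "quasi_polynomial L q"
  shows "\<exists>D. coset_expansion L q D"
  using assms(2)
proof induction
  case (polynomial p)
  then obtain P where "poly_family P" "\<forall>t z. p (t *\<^sub>R z) = poly (P z) (of_real t)"
    using polynomial_function_expansion by blast
  then show ?case
    unfolding coset_expansion_def by (intro exI[of _ 1]) auto
next
  case (periodic f)
  then obtain D where D: "D > 0" "\<And>x y. x \<in> L \<Longrightarrow> y \<in> L \<Longrightarrow> f (x + real D *\<^sub>R y) = f x"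
    unfolding lattice_periodic_def by blast
  have "coset_expansion L f D"
    unfolding coset_expansion_def
  proof (intro conjI ballI D)
    fix x assume "x \<in> L"
    then show "\<exists>P. poly_family P \<and> (\<forall>y\<in>L. \<forall>t z. x + real D *\<^sub>R y = t *\<^sub>R z \<longrightarrow>
        f (x + real D *\<^sub>R y) = poly (P z) (of_real t))"
      by (intro exI[of _ "\<lambda>_. [:f x:]"] conjI ballI allI impI poly_family_const)
        (metis D(2) add_0_right mult_zero_right poly_0 poly_pCons)
  qed
  then show ?case by blast
next
  case (add f g)
  then obtain D E where "coset_expansion L f D" "coset_expansion L g E"
    by blast
  then have "coset_expansion L f (D * E)" "coset_expansion L g (D * E)"
    using coset_expansion_multiple[OF L, of f D E] coset_expansion_multiple[OF L, of g E D]
    by (simp_all add: coset_expansion_def[of _ _ D] coset_expansion_def[of _ _ E] mult.commute)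
  then have "coset_expansion L (\<lambda>x. f x + g x) (D * E)"
    by (rule coset_expansion_add)
  then show ?case by blast
next
  case (mult f g)
  then obtain D E where "coset_expansion L f D" "coset_expansion L g E"
    by blast
  then have "coset_expansion L f (D * E)" "coset_expansion L g (D * E)"
    using coset_expansion_multiple[OF L, of f D E] coset_expansion_multiple[OF L, of g E D]
    by (simp_all add: coset_expansion_def[of _ _ D] coset_expansion_def[of _ _ E] mult.commute)
  then have "coset_expansion L (\<lambda>x. f x * g x) (D * E)"
    by (rule coset_expansion_mult)
  then show ?case by blast
qed

section \<open>Characters of finite order\<close>

lemma exp_2pi_i_cong:
  assumes "s - t \<in> \<int>"
  shows "exp (2 * \<i> * of_real pi * of_real s) = (exp (2 * \<i> * of_real pi * of_real t) :: complex)"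
proof -
  obtain z where "s - t = of_int z"
    using assms by (elim Ints_cases)
  then have "s = t + of_int z"
    by simp
  then have "exp (2 * \<i> * of_real pi * of_real s) =
      exp (2 * \<i> * of_real pi * of_real t) * (exp ((2 * of_int z * of_real pi) * \<i>) :: complex)"
    by (simp only: exp_add[symmetric]) (simp add: algebra_simps)
  also have "exp ((2 * of_int z * of_real pi) * \<i>) = (1 :: complex)"
    using exp_integer_2pi[of "real_of_int z"] by simp
  finally show ?thesis by simp
qed

lemma torus_representative:
  assumes "g \<in> torus \<Lambda>"
  shows "(SOME G. G \<in> g) \<in> g" "g \<subseteq> dual_space"
proof -
  have "(\<lambda>x. 0) \<in> dual_lattice \<Lambda>"
    by (auto simp: dual_lattice_def dual_space_def intro: linear_zero)
  then have "\<exists>G. G \<in> g"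
    using assms by (auto simp: torus_def quotient_def)
  then show "(SOME G. G \<in> g) \<in> g"
    by (rule someI_ex)
  show "g \<subseteq> dual_space"
    using assms by (auto simp: torus_def quotient_def)
qed

lemma torus_power_periodic:
  assumes "g \<in> torus \<Lambda>" "finite_order \<Lambda> g"
  shows "lattice_periodic (ext_lattice \<Lambda>) (\<lambda>x. torus_power g (fst x))"
proof -
  define G where "G = (SOME G. G \<in> g)"
  have "G \<in> g" "linear G"
    using torus_representative[OF assms(1)] by (auto simp: G_def dual_space_def)
  then obtain n :: nat where n: "n > 0" "\<And>y. y \<in> \<Lambda> \<Longrightarrow> real n * G y \<in> \<int>"
    using assms(2) by (auto simp: finite_order_def dual_lattice_def)
  have "torus_power g (x + real n *\<^sub>R y) = torus_power g x" if "y \<in> \<Lambda>" for x y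
    unfolding torus_power_def G_def[symmetric]
    by (rule exp_2pi_i_cong) (use n(2)[OF that] \<open>linear G\<close> in \<open>simp add: linear_add linear_scale\<close>)
  then show ?thesis
    using n(1) unfolding lattice_periodic_def by (intro exI[of _ n]) (auto simp: ext_lattice_def)
qed

text \<open>A character of finite order is periodic and can be absorbed into each quasi-polynomial
  factor.\<close>

lemma twist_in_space_S:
  assumes "g \<in> torus \<Lambda>" "finite_order \<Lambda> g" "m \<in> space_S \<Lambda>"
  shows "twist g m \<in> space_S \<Lambda>"
proof -
  obtain n c q P where q: "\<And>i. i < (n::nat) \<Longrightarrow> quasi_polynomial (ext_lattice \<Lambda>) (q i)"
    and P: "\<And>i. i < n \<Longrightarrow> rational_polyhedron \<Lambda> (P i)"
    and m: "m = (\<lambda>x. \<Sum>i<n. c i * restrict_cone \<Lambda> (q i) (P i) x)"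
    using assms(3) unfolding space_S_def by blast
  have "quasi_polynomial (ext_lattice \<Lambda>) (\<lambda>x. torus_power g (fst x) * q i x)" if "i < n" for i
    using quasi_polynomial.mult[OF quasi_polynomial.periodic[OF torus_power_periodic[OF assms(1,2)]] q[OF that]] .
  moreover have "twist g m = (\<lambda>x. \<Sum>i<n. c i * restrict_cone \<Lambda> (\<lambda>x. torus_power g (fst x) * q i x) (P i) x)"
    unfolding m twist_def restrict_cone_def
    by (auto simp: fun_eq_iff sum_distrib_left mult_ac intro!: sum.cong)
  ultimately show ?thesis
    unfolding space_S_def mem_Collect_eq using P
    by (intro exI[of _ n] exI[of _ c] exI[of _ "\<lambda>i x. torus_power g (fst x) * q i x"] exI[of _ P]) blast
qed

text \<open>\<open>torus_power\<close> evaluates a chosen representative, which differs from G by a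
  functional with integral values on the lattice; the exponential does not see this.\<close>

lemma torus_element_exists:
  assumes G: "linear G" and n: "n > (0::nat)" "\<And>x. x \<in> \<Lambda> \<Longrightarrow> real n * G x \<in> \<int>"
  shows "\<exists>g\<in>torus \<Lambda>. finite_order \<Lambda> g \<and>
    (\<forall>\<mu>\<in>\<Lambda>. torus_power g \<mu> = exp (2 * \<i> * of_real pi * of_real (G \<mu>)))"
proof -
  define r where "r = {(G, H). G \<in> dual_space \<and> H \<in> dual_space \<and> (\<lambda>x. G x - H x) \<in> dual_lattice \<Lambda>}"
  define g where "g = r `` {G}"
  have g_iff: "H \<in> g \<longleftrightarrow> H \<in> dual_space \<and> (\<lambda>x. G x - H x) \<in> dual_lattice \<Lambda>" for H
  proof -
    have "H \<in> g \<longleftrightarrow> (G, H) \<in> r"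
      unfolding g_def by (rule Image_singleton_iff)
    moreover have "G \<in> dual_space"
      unfolding dual_space_def mem_Collect_eq by (rule G)
    ultimately show ?thesis
      unfolding r_def by blast
  qed
  have mem: "linear H \<and> (\<forall>\<mu>\<in>\<Lambda>. G \<mu> - H \<mu> \<in> \<int>)" if "H \<in> g" for H
    using that unfolding g_iff dual_space_def dual_lattice_def by blast
  have g: "g \<in> torus \<Lambda>"
    unfolding torus_def r_def[symmetric] g_def using G by (intro quotientI) (simp add: dual_space_def)
  have "finite_order \<Lambda> g"
    unfolding finite_order_def
  proof (intro exI[of _ n] conjI ballI n)
    fix H assume "H \<in> g"
    then have H: "linear H" "\<And>\<mu>. \<mu> \<in> \<Lambda> \<Longrightarrow> G \<mu> - H \<mu> \<in> \<int>"
      using mem by blast+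
    have "real n * H \<mu> \<in> \<int>" if "\<mu> \<in> \<Lambda>" for \<mu>
    proof -
      have "real n * H \<mu> = real n * G \<mu> - real n * (G \<mu> - H \<mu>)"
        by (simp add: algebra_simps)
      then show ?thesis
        using n(2)[OF that] H(2)[OF that] by (metis Ints_diff Ints_mult Ints_of_nat)
    qed
    moreover have "linear (\<lambda>x. real n * H x)"
      using H(1) by (intro linear_compose_scale_right[where 'b = real, unfolded real_scaleR_def])
    ultimately show "(\<lambda>x. real n * H x) \<in> dual_lattice \<Lambda>"
      by (simp add: dual_lattice_def dual_space_def)
  qed
  moreover have "torus_power g \<mu> = exp (2 * \<i> * of_real pi * of_real (G \<mu>))" if "\<mu> \<in> \<Lambda>" for \<mu>
  proof -
    define H where "H = (SOME H. H \<in> g)"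
    have "H \<in> g"
      using torus_representative(1)[OF g] by (simp add: H_def)
    then have "G \<mu> - H \<mu> \<in> \<int>"
      using that mem by blast
    then show ?thesis
      unfolding torus_power_def H_def[symmetric] by (rule exp_2pi_i_cong[symmetric])
  qed
  ultimately show ?thesis
    by (intro bexI[OF _ g] conjI ballI) simp_all
qed

section \<open>From vanishing expansions to sums over cosets of the lattice\<close>

lemma A_zero_tendsto_0:
  assumes "A_zero \<Lambda> m" "test_function \<phi>"
  shows "(\<lambda>k. Theta \<Lambda> m k \<phi>) \<longlonglongrightarrow> 0"
proof -
  obtain n0 \<theta> where exp: "asymptotic_expansion (Theta \<Lambda> m) n0 \<theta>"
    and zero: "\<And>n k \<phi>. test_function \<phi> \<Longrightarrow> \<theta> n k \<phi> = 0"
    using assms(1) unfolding A_zero_def by blast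
  \<comment> \<open>Truncation at \<open>nat n0\<close> makes the exponent of the error term
    nonpositive, so the error tends to 0 whatever the sign of n0.\<close>
  have "(\<lambda>k. Theta \<Lambda> m k \<phi> - of_nat k powi n0 * (\<Sum>n\<le>nat n0. 1 / of_nat k ^ n * \<theta> n (int k) \<phi>))
      \<in> o(\<lambda>k. of_nat k powi (n0 - int (nat n0)) :: complex)"
    using exp assms(2) unfolding asymptotic_expansion_def by blast
  then have "(\<lambda>k. Theta \<Lambda> m k \<phi>) \<in> o(\<lambda>k. of_nat k powi (n0 - int (nat n0)) :: complex)"
    by (simp add: zero[OF assms(2)])
  also have "(\<lambda>k. of_nat k powi (n0 - int (nat n0)) :: complex) \<in> O(\<lambda>_. 1)"
  proof (intro bigoI[of _ 1] eventually_mono[OF eventually_gt_at_top[of 0]])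
    fix k :: nat assume "k > 0"
    have "real k powi (n0 - int (nat n0)) \<le> 1"
      using \<open>k > 0\<close> by (auto simp: power_int_def nat_diff_distrib inverse_le_1_iff power_le_one)
    then show "norm (of_nat k powi (n0 - int (nat n0)) :: complex) \<le> 1 * norm (1::complex)"
      by (simp add: norm_power_int)
  qed
  finally show ?thesis
    by (auto dest: smalloD_tendsto)
qed

lemma sum_roots_of_unity:
  fixes z :: int
  assumes "D > (0::nat)"
  shows "(\<Sum>j<D. exp (2 * \<i> * of_real pi * of_real (real j / real D * of_int z))) =
    (if int D dvd z then of_nat D else (0::complex))"
proof -
  define w :: complex where "w = exp (2 * \<i> * of_real pi * (of_int z / of_nat D))"
  have pow: "exp (2 * \<i> * of_real pi * of_real (real j / real D * of_int z)) = w ^ j" for j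
    by (simp add: w_def exp_of_nat_mult[symmetric] mult_ac)
  have "w ^ D = exp (2 * of_real pi * \<i> * of_int z)"
    using assms by (simp add: w_def exp_of_nat_mult[symmetric] mult_ac)
  also have "\<dots> = 1"
    using exp_2pi_i_cong[of "of_int z" 0] by (simp add: mult_ac)
  finally have wD: "w ^ D = 1" .
  have "w = 1 \<longleftrightarrow> (\<exists>n::int. 2 * pi * (of_int z / real D) = of_int (2 * n) * pi)"
    unfolding w_def exp_eq_1 by (simp add: Re_divide_of_nat Im_divide_of_nat)
  also have "\<dots> \<longleftrightarrow> (\<exists>n::int. z = int D * n)"
  proof (intro ex_cong1)
    fix n :: int
    have "2 * pi * (of_int z / real D) = of_int (2 * n) * pi \<longleftrightarrow> (of_int z :: real) = of_int (int D * n)"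
      using assms by (simp add: field_simps)
    then show "2 * pi * (of_int z / real D) = of_int (2 * n) * pi \<longleftrightarrow> z = int D * n"
      by (simp only: of_int_eq_iff)
  qed
  finally have "w = 1 \<longleftrightarrow> int D dvd z"
    by (auto simp: dvd_def)
  moreover have "(\<Sum>j<D. w ^ j) = 0" if "w \<noteq> 1"
    using geometric_sum[OF that, of D] wD by simp
  ultimately show ?thesis
    unfolding pow by auto
qed

context lattice_basis
begin

lemma lattice_closed:
  assumes "x \<in> \<Lambda>"
  shows "y \<in> \<Lambda> \<Longrightarrow> x + y \<in> \<Lambda>" "y \<in> \<Lambda> \<Longrightarrow> x - y \<in> \<Lambda>" "real n *\<^sub>R x \<in> \<Lambda>"
  using assms by (auto simp: mem_lattice_iff)

lemma zero_in_lattice: "0 \<in> \<Lambda>"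
  by (simp add: mem_lattice_iff)

text \<open>The floor only moves coordinates that are already integers to type int, where
  divisibility makes sense.\<close>

lemma mem_sublattice_coset_iff:
  assumes "D > 0" "a \<in> \<Lambda>" "\<mu> \<in> \<Lambda>"
  shows "(\<exists>y\<in>\<Lambda>. \<mu> = a + real D *\<^sub>R y) \<longleftrightarrow> (\<forall>b\<in>B. int D dvd \<lfloor>coord b (\<mu> - a)\<rfloor>)"
proof
  assume "\<exists>y\<in>\<Lambda>. \<mu> = a + real D *\<^sub>R y"
  then obtain y where y: "y \<in> \<Lambda>" "\<mu> = a + real D *\<^sub>R y"
    by blast
  show "\<forall>b\<in>B. int D dvd \<lfloor>coord b (\<mu> - a)\<rfloor>"
  proof
    fix b assume "b \<in> B"
    then obtain z where "coord b y = of_int z"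
      using y(1) by (auto simp: mem_lattice_iff elim: Ints_cases)
    then have "coord b (\<mu> - a) = of_int (int D * z)"
      by (simp add: y(2))
    then show "int D dvd \<lfloor>coord b (\<mu> - a)\<rfloor>"
      by (simp only: floor_of_int dvd_triv_left)
  qed
next
  assume dvd: "\<forall>b\<in>B. int D dvd \<lfloor>coord b (\<mu> - a)\<rfloor>"
  define y where "y = (\<mu> - a) /\<^sub>R real D"
  have "coord b y \<in> \<int>" if b: "b \<in> B" for b
  proof -
    obtain z where "\<lfloor>coord b (\<mu> - a)\<rfloor> = int D * z"
      using bspec[OF dvd b] by (rule dvdE)
    moreover have "of_int \<lfloor>coord b (\<mu> - a)\<rfloor> = coord b (\<mu> - a)"
      using lattice_closed(2)[OF assms(3,2)] that unfolding mem_lattice_iff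
      by (metis Ints_cases floor_of_int)
    ultimately have "coord b (\<mu> - a) = real D * of_int z"
      by simp
    then have "coord b y = of_int z"
      using \<open>D > 0\<close> by (simp add: y_def field_simps)
    then show ?thesis by simp
  qed
  then have "y \<in> \<Lambda>"
    by (simp add: mem_lattice_iff)
  then show "\<exists>y\<in>\<Lambda>. \<mu> = a + real D *\<^sub>R y"
    using \<open>D > 0\<close> by (intro bexI[of _ y]) (simp_all add: y_def)
qed

text \<open>Orthogonality of characters: the tuples J enumerate the characters of \<Lambda> / D
  \<Lambda>, and the sum over them factors into one geometric sum for each basis vector.\<close>

lemma sublattice_coset_indicator:
  assumes "D > 0" "a \<in> \<Lambda>" "\<mu> \<in> \<Lambda>"
  shows "(\<Sum>J\<in>PiE B (\<lambda>_. {..<D}).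
      exp (2 * \<i> * of_real pi * of_real (\<Sum>b\<in>B. real (J b) / real D * coord b (\<mu> - a)))) =
    (if \<exists>y\<in>\<Lambda>. \<mu> = a + real D *\<^sub>R y then of_nat D ^ card B else (0::complex))"
proof -
  have int: "coord b (\<mu> - a) = of_int \<lfloor>coord b (\<mu> - a)\<rfloor>" if "b \<in> B" for b
    using lattice_closed(2)[OF assms(3,2)] that unfolding mem_lattice_iff
    by (metis Ints_cases floor_of_int)
  have "(\<Sum>J\<in>PiE B (\<lambda>_. {..<D}).
      exp (2 * \<i> * of_real pi * of_real (\<Sum>b\<in>B. real (J b) / real D * coord b (\<mu> - a)))) =
      (\<Sum>J\<in>PiE B (\<lambda>_. {..<D}).
      \<Prod>b\<in>B. exp (2 * \<i> * of_real pi * of_real (real (J b) / real D * coord b (\<mu> - a))))"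
    by (simp only: of_real_sum sum_distrib_left exp_sum[OF finite_basis])
  also have "\<dots> = (\<Prod>b\<in>B. \<Sum>j<D. exp (2 * \<i> * of_real pi * of_real (real j / real D * coord b (\<mu> - a))))"
    by (rule prod_sum_PiE[symmetric]) (auto simp: finite_basis)
  also have "\<dots> = (\<Prod>b\<in>B. if int D dvd \<lfloor>coord b (\<mu> - a)\<rfloor> then of_nat D else 0)"
    by (intro prod.cong refl, subst int, assumption, rule sum_roots_of_unity[OF assms(1)])
  also have "\<dots> = (if \<exists>y\<in>\<Lambda>. \<mu> = a + real D *\<^sub>R y then of_nat D ^ card B else 0)"
    unfolding mem_sublattice_coset_iff[OF assms] using finite_basis by auto
  finally show ?thesis .
qed

lemma Theta_bump:
  assumes "k \<ge> 1"
  shows "Theta \<Lambda> m k (\<lambda>x. of_real (bump a r x)) =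
    (\<Sum>\<mu>\<in>{\<mu> \<in> \<Lambda>. bump a r (\<mu> /\<^sub>R real k) \<noteq> 0}. m (\<mu>, real k) * of_real (bump a r (\<mu> /\<^sub>R real k)))"
proof -
  have "Theta \<Lambda> m k (\<lambda>x. of_real (bump a r x)) =
    (\<Sum>\<^sub>\<infinity>\<mu>\<in>{\<mu> \<in> \<Lambda>. bump a r (\<mu> /\<^sub>R real k) \<noteq> 0}. m (\<mu>, real k) * of_real (bump a r (\<mu> /\<^sub>R real k)))"
    unfolding Theta_def by (rule infsum_cong_neutral) auto
  then show ?thesis
    by (simp only: infsum_finite[OF finite_bump_support[OF assms]])
qed

text \<open>The coset indicator is a finite combination of characters, and each of these gives a
  sequence tending to 0. Only \<mu> is restricted here; the residue of k is fixed later by passing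
  to a subsequence.\<close>

lemma coset_sum_tendsto_0:
  assumes A: "\<And>g. g \<in> torus \<Lambda> \<Longrightarrow> finite_order \<Lambda> g \<Longrightarrow> A_zero \<Lambda> (twist g m)"
    and D: "D > 0" and \<mu>1: "\<mu>1 \<in> \<Lambda>"
  shows "(\<lambda>k. \<Sum>\<mu>\<in>{\<mu> \<in> \<Lambda>. bump a r (\<mu> /\<^sub>R real k) \<noteq> 0 \<and> (\<exists>y\<in>\<Lambda>. \<mu> = \<mu>1 + real D *\<^sub>R y)}.
    m (\<mu>, real k) * of_real (bump a r (\<mu> /\<^sub>R real k))) \<longlonglongrightarrow> 0" (is "?s \<longlonglongrightarrow> 0")
proof -
  let ?e = "\<lambda>t. exp (2 * \<i> * of_real pi * of_real t) :: complex"
  let ?G = "\<lambda>J x. \<Sum>b\<in>B. real (J b) / real D * coord b x"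
  let ?I = "PiE B (\<lambda>_. {..<D})"
  let ?\<phi> = "\<lambda>x. of_real (bump a r x) :: complex"
  have "\<exists>g\<in>torus \<Lambda>. finite_order \<Lambda> g \<and> (\<forall>\<mu>\<in>\<Lambda>. torus_power g \<mu> = ?e (?G J \<mu>))" for J :: "'a \<Rightarrow> nat"
  proof (rule torus_element_exists)
    show "linear (?G J)"
      by (rule linearI) (simp_all add: sum.distrib sum_distrib_left algebra_simps)
    show "real D * ?G J x \<in> \<int>" if "x \<in> \<Lambda>" for x
    proof -
      have "real D * ?G J x = (\<Sum>b\<in>B. real (J b) * coord b x)"
        using D by (simp add: sum_distrib_left)
      also have "\<dots> \<in> \<int>"
        using that by (intro Ints_sum Ints_mult) (auto simp: mem_lattice_iff)
      finally show ?thesis .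
    qed
  qed (rule D)
  then obtain g where g: "\<And>J. g J \<in> torus \<Lambda>" "\<And>J. finite_order \<Lambda> (g J)"
    "\<And>J \<mu>. \<mu> \<in> \<Lambda> \<Longrightarrow> torus_power (g J) \<mu> = ?e (?G J \<mu>)"
    by metis
  \<comment> \<open>The constant phase at \<open>\<mu>1\<close> translates the indicator from D
    \<Lambda> to the coset of \<open>\<mu>1\<close>.\<close>
  have lim: "(\<lambda>k. \<Sum>J\<in>?I. ?e (- ?G J \<mu>1) * Theta \<Lambda> (twist (g J) m) k ?\<phi>) \<longlonglongrightarrow> 0"
  proof (rule tendsto_null_sum)
    fix J
    have "(\<lambda>k. Theta \<Lambda> (twist (g J) m) k ?\<phi>) \<longlonglongrightarrow> 0"
      by (intro A_zero_tendsto_0 A g test_function_bump)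
    then show "(\<lambda>k. ?e (- ?G J \<mu>1) * Theta \<Lambda> (twist (g J) m) k ?\<phi>) \<longlonglongrightarrow> 0"
      by (rule tendsto_mult_right_zero)
  qed
  have eq: "(\<Sum>J\<in>?I. ?e (- ?G J \<mu>1) * Theta \<Lambda> (twist (g J) m) k ?\<phi>) = of_nat D ^ card B * ?s k" if "k \<ge> 1" for k
  proof -
    let ?S = "{\<mu> \<in> \<Lambda>. bump a r (\<mu> /\<^sub>R real k) \<noteq> 0}"
    have e: "?e (- ?G J \<mu>1) * ?e (?G J \<mu>) = ?e (?G J (\<mu> - \<mu>1))" for J \<mu>
      by (simp add: exp_add[symmetric] sum_subtractf algebra_simps)
    have "(\<Sum>J\<in>?I. ?e (- ?G J \<mu>1) * Theta \<Lambda> (twist (g J) m) k ?\<phi>) =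
        (\<Sum>J\<in>?I. \<Sum>\<mu>\<in>?S. ?e (?G J (\<mu> - \<mu>1)) * (m (\<mu>, real k) * ?\<phi> (\<mu> /\<^sub>R real k)))"
      unfolding Theta_bump[OF that] sum_distrib_left
    proof (intro sum.cong refl)
      fix J \<mu> assume "\<mu> \<in> ?S"
      then have tw: "twist (g J) m (\<mu>, real k) = ?e (?G J \<mu>) * m (\<mu>, real k)"
        using g(3)[of \<mu> J] by (simp add: twist_def)
      then show "?e (- ?G J \<mu>1) * (twist (g J) m (\<mu>, real k) * ?\<phi> (\<mu> /\<^sub>R real k)) =
          ?e (?G J (\<mu> - \<mu>1)) * (m (\<mu>, real k) * ?\<phi> (\<mu> /\<^sub>R real k))"
        unfolding tw e[symmetric] by (simp only: mult.assoc)
    qed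
    also have "\<dots> = (\<Sum>\<mu>\<in>?S. (\<Sum>J\<in>?I. ?e (?G J (\<mu> - \<mu>1))) * (m (\<mu>, real k) * ?\<phi> (\<mu> /\<^sub>R real k)))"
      by (subst sum.swap) (simp only: sum_distrib_right)
    also have "\<dots> = (\<Sum>\<mu>\<in>?S. (if \<exists>y\<in>\<Lambda>. \<mu> = \<mu>1 + real D *\<^sub>R y then of_nat D ^ card B else 0) *
        (m (\<mu>, real k) * ?\<phi> (\<mu> /\<^sub>R real k)))"
      by (intro sum.cong refl arg_cong2[where f = "(*)"] sublattice_coset_indicator D \<mu>1) simp
    also have "\<dots> = (\<Sum>\<mu>\<in>{\<mu> \<in> \<Lambda>. bump a r (\<mu> /\<^sub>R real k) \<noteq> 0 \<and> (\<exists>y\<in>\<Lambda>. \<mu> = \<mu>1 + real D *\<^sub>R y)}.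
        of_nat D ^ card B * (m (\<mu>, real k) * ?\<phi> (\<mu> /\<^sub>R real k)))"
      using finite_bump_support[OF that, of a r] by (intro sum.mono_neutral_cong_right) auto
    finally show ?thesis
      by (simp only: sum_distrib_left)
  qed
  have "(\<lambda>k. of_nat D ^ card B * ?s k) \<longlonglongrightarrow> 0"
    by (rule Lim_transform_eventually[OF lim]) (use eq in \<open>auto simp: eventually_at_top_linorder\<close>)
  then have "(\<lambda>k. inverse (of_nat D ^ card B) * (of_nat D ^ card B * ?s k)) \<longlonglongrightarrow> inverse (of_nat D ^ card B) * 0"
    by (intro tendsto_mult_left)
  then show ?thesis
    using D by (simp add: mult.assoc[symmetric])
qed

end

section \<open>Sums over polyhedra\<close>

text \<open>The factor cnj a gives a top coefficient close to a a large positive real part. The top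
  term contributes at least |a|^2/2 times k^J; since k^j \<le> k^J / k for j < J, the lower terms
  take away at most half of that.\<close>

lemma poly_dominant_bound:
  fixes p :: "complex poly"
  assumes "\<And>j. j > J \<Longrightarrow> coeff p j = 0" "Re (cnj a * coeff p J) \<ge> (norm a)\<^sup>2 / 2"
    "\<And>j. j < J \<Longrightarrow> norm (coeff p j) \<le> M" "k \<ge> 1" "norm a * (real J * M) / real k \<le> (norm a)\<^sup>2 / 4"
  shows "Re (cnj a * poly p (of_nat k)) \<ge> (norm a)\<^sup>2 / 4"
proof -
  let ?K = "of_nat k :: complex"
  have "degree p \<le> J"
    using assms(1) by (intro degree_le) auto
  then have "poly p ?K = (\<Sum>j\<le>J. coeff p j * ?K ^ j)"
    unfolding poly_altdef using assms(1) by (intro sum.mono_neutral_left) (auto simp: coeff_eq_0)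
  also have "\<dots> = (\<Sum>j<J. coeff p j * ?K ^ j) + coeff p J * ?K ^ J"
    by (simp add: lessThan_Suc_atMost[symmetric])
  finally have poly_eq: "poly p ?K = (\<Sum>j<J. coeff p j * ?K ^ j) + coeff p J * ?K ^ J" .
  have low: "norm (\<Sum>j<J. coeff p j * ?K ^ j) \<le> real J * M * (real k ^ J / real k)"
  proof -
    have "norm (\<Sum>j<J. coeff p j * ?K ^ j) \<le> (\<Sum>j<J. M * (real k ^ J / real k))"
    proof (rule sum_norm_le)
      fix j assume j: "j \<in> {..<J}"
      have "real k ^ j * real k \<le> real k ^ J"
        using j \<open>k \<ge> 1\<close> power_increasing[of "Suc j" J "real k"] by (simp add: mult.commute)
      then have "real k ^ j \<le> real k ^ J / real k"
        using \<open>k \<ge> 1\<close> by (simp add: field_simps)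
      moreover have "M \<ge> 0"
        using assms(3)[of j] j by (meson lessThan_iff norm_ge_zero order_trans)
      ultimately show "norm (coeff p j * ?K ^ j) \<le> M * (real k ^ J / real k)"
        using assms(3)[of j] j unfolding norm_mult norm_power norm_of_nat by (intro mult_mono) auto
    qed
    then show ?thesis by (simp add: mult.assoc)
  qed
  have "norm (cnj a * (\<Sum>j<J. coeff p j * ?K ^ j)) \<le> norm a * (real J * M * (real k ^ J / real k))"
    unfolding norm_mult complex_mod_cnj by (rule mult_left_mono[OF low norm_ge_zero])
  also have "\<dots> = norm a * (real J * M) / real k * real k ^ J"
    by simp
  also have "\<dots> \<le> (norm a)\<^sup>2 / 4 * real k ^ J"
    by (intro mult_right_mono assms) auto
  finally have "Re (cnj a * (\<Sum>j<J. coeff p j * ?K ^ j)) \<ge> - ((norm a)\<^sup>2 / 4 * real k ^ J)"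
    using abs_Re_le_cmod[of "cnj a * (\<Sum>j<J. coeff p j * ?K ^ j)"] by linarith
  moreover have "Re (cnj a * (coeff p J * ?K ^ J)) \<ge> (norm a)\<^sup>2 / 2 * real k ^ J"
  proof -
    have "cnj a * (coeff p J * ?K ^ J) = of_real (real k ^ J) * (cnj a * coeff p J)"
      by simp
    then have "Re (cnj a * (coeff p J * ?K ^ J)) = real k ^ J * Re (cnj a * coeff p J)"
      by (simp only: Re_complex_of_real Im_complex_of_real times_complex.sel(1))
    then show ?thesis
      using mult_left_mono[OF assms(2), of "real k ^ J"] by (simp add: mult.commute)
  qed
  ultimately have "Re (cnj a * poly p ?K) \<ge> (norm a)\<^sup>2 / 4 * real k ^ J"
    unfolding poly_eq distrib_left plus_complex.sel(1) by linarith
  moreover have "(norm a)\<^sup>2 / 4 * real k ^ J \<ge> (norm a)\<^sup>2 / 4 * 1"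
    using \<open>k \<ge> 1\<close> by (intro mult_left_mono one_le_power) auto
  ultimately show ?thesis by linarith
qed


context lattice_basis
begin

lemma ext_lattice_scale: "x \<in> ext_lattice \<Lambda> \<Longrightarrow> real n *\<^sub>R x \<in> ext_lattice \<Lambda>"
  by (auto simp: ext_lattice_def lattice_closed(3))

lemma linear_signs_locally_constant:
  fixes F :: "(('a \<Rightarrow> real) \<times> real) set"
  assumes "finite F" and lin: "\<And>l c. (l, c) \<in> F \<Longrightarrow> linear l"
  shows "\<exists>U. open U \<and> \<xi> \<in> U \<and> (\<forall>\<eta>\<in>U. \<forall>(l, c)\<in>F. l \<xi> \<noteq> c \<longrightarrow> sgn (l \<eta> - c) = sgn (l \<xi> - c))"
proof (intro exI conjI)
  \<comment> \<open>Having the same nonzero sign is written as positivity of a product, an open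
    condition on \<eta>.\<close>
  let ?U = "\<Inter>(l, c)\<in>{(l, c) \<in> F. l \<xi> \<noteq> c}. {\<eta>. (l \<eta> - c) * (l \<xi> - c) > 0}"
  have "finite {(l, c) \<in> F. l \<xi> \<noteq> c}"
    using \<open>finite F\<close> by (rule rev_finite_subset) auto
  then show "open ?U"
  proof (intro open_INT ballI)
    fix p assume p: "p \<in> {(l, c) \<in> F. l \<xi> \<noteq> c}"
    obtain l c where lc: "p = (l, c)"
      by (cases p)
    then have "continuous_on UNIV l"
      using p lin by (intro continuous_on_linear_functional) auto
    then show "open (case p of (l, c) \<Rightarrow> {\<eta>. (l \<eta> - c) * (l \<xi> - c) > 0})"
      unfolding lc case_prod_conv by (intro open_Collect_less continuous_intros)
  qed
  show "\<xi> \<in> ?U"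
    by (auto simp: zero_less_mult_iff)
  show "\<forall>\<eta>\<in>?U. \<forall>(l, c)\<in>F. l \<xi> \<noteq> c \<longrightarrow> sgn (l \<eta> - c) = sgn (l \<xi> - c)"
    by (fastforce simp: zero_less_mult_iff)
qed

end

section \<open>A fixed presentation of m and its local form near a point\<close>

locale polyhedral_sum = lattice_basis B \<Lambda>
  for B :: "'a::real_normed_vector set" and \<Lambda> :: "'a set" +
  fixes n :: nat and c :: "nat \<Rightarrow> complex" and q :: "nat \<Rightarrow> 'a \<times> real \<Rightarrow> complex"
    and F :: "nat \<Rightarrow> (('a \<Rightarrow> real) \<times> real) set" and P :: "nat \<Rightarrow> 'a set"
    and m :: "'a \<times> real \<Rightarrow> complex"
  assumes quasi: "\<And>i. i < n \<Longrightarrow> quasi_polynomial (ext_lattice \<Lambda>) (q i)"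
    and finite_F: "\<And>i. i < n \<Longrightarrow> finite (F i)"
    and linear_F: "\<And>i l a. i < n \<Longrightarrow> (l, a) \<in> F i \<Longrightarrow> linear l"
    and rational_F: "\<And>i l a. i < n \<Longrightarrow> (l, a) \<in> F i \<Longrightarrow> (\<forall>\<mu>\<in>\<Lambda>. l \<mu> \<in> \<rat>) \<and> a \<in> \<rat>"
    and P_eq: "\<And>i. i < n \<Longrightarrow> P i = {x. \<forall>(l, a)\<in>F i. l x \<le> a}"
    and m_eq: "m = (\<lambda>x. \<Sum>i<n. c i * restrict_cone \<Lambda> (q i) (P i) x)"
begin

definition all_F :: "(('a \<Rightarrow> real) \<times> real) set" where
  "all_F = (\<Union>i<n. F i)"

text \<open>The inequalities of all polyhedra are pooled, so this describes the face of \<xi> in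
  their common subdivision; its cardinality is the quantity to be minimized.\<close>

definition tight :: "'a \<Rightarrow> (('a \<Rightarrow> real) \<times> real) set" where
  "tight \<xi> = {(l, a) \<in> all_F. l \<xi> = a}"

text \<open>The quasi-polynomial that m equals at (\<mu>, k), k \<ge> 1, whenever \<mu> / k lies in
  the same polyhedra as \<xi>.\<close>

definition local_q :: "'a \<Rightarrow> 'a \<times> real \<Rightarrow> complex" where
  "local_q \<xi> x = (\<Sum>i\<in>{i. i < n \<and> \<xi> \<in> P i}. c i * q i x)"

lemma finite_all_F: "finite all_F"
  by (auto simp: all_F_def finite_F)

lemma linear_all_F: "(l, a) \<in> all_F \<Longrightarrow> linear l"
  by (auto simp: all_F_def linear_F)

lemma finite_tight: "finite (tight \<xi>)"
  unfolding tight_def by (rule rev_finite_subset[OF finite_all_F]) auto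

lemma quasi_local_q: "quasi_polynomial (ext_lattice \<Lambda>) (local_q \<xi>)"
  unfolding local_q_def [abs_def]
  by (intro quasi_polynomial_sum quasi_polynomial.mult quasi_polynomial_const quasi) auto

lemma m_eq_local_q:
  assumes "\<mu> \<in> \<Lambda>" "k \<ge> 1" "\<And>i. i < n \<Longrightarrow> \<mu> /\<^sub>R real k \<in> P i \<longleftrightarrow> \<xi> \<in> P i"
  shows "m (\<mu>, real k) = local_q \<xi> (\<mu>, real k)"
proof -
  have "m (\<mu>, real k) = (\<Sum>i<n. if \<xi> \<in> P i then c i * q i (\<mu>, real k) else 0)"
    unfolding m_eq using assms
    by (intro sum.cong refl) (auto simp: restrict_cone_def ext_lattice_def cone_over_pos)
  also have "\<dots> = local_q \<xi> (\<mu>, real k)"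
    unfolding local_q_def by (intro sum.mono_neutral_cong_right) auto
  finally show ?thesis .
qed

text \<open>At level 0 the cone has at most its apex, even over an unbounded polyhedron. Only the
  origin and the levels k \<ge> 1 are left to treat.\<close>

lemma m_eq_0:
  assumes "\<mu> \<notin> \<Lambda> \<or> t \<notin> \<int> \<or> t < 0 \<or> t = 0 \<and> \<mu> \<noteq> 0"
  shows "m (\<mu>, t) = 0"
proof -
  have "\<not> ((\<mu>, t) \<in> ext_lattice \<Lambda> \<and> (\<mu>, t) \<in> cone_over (P i))" for i
    using assms by (auto simp: ext_lattice_def cone_over_zero cone_over_neg)
  then show ?thesis
    unfolding m_eq restrict_cone_def by (intro sum.neutral ballI) auto
qed

lemma m_origin: "m (0, 0) = (\<Sum>i<n. if P i \<noteq> {} then c i * q i (0, 0) else 0)"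
  unfolding m_eq
  by (intro sum.cong refl) (auto simp: restrict_cone_def ext_lattice_def cone_over_zero zero_in_lattice)

lemma same_polyhedra:
  assumes "\<And>l a. (l, a) \<in> all_F \<Longrightarrow> sgn (l \<eta> - a) = sgn (l \<xi> - a)" "i < n"
  shows "\<eta> \<in> P i \<longleftrightarrow> \<xi> \<in> P i"
proof -
  have "l \<eta> \<le> a \<longleftrightarrow> l \<xi> \<le> a" if "(l, a) \<in> F i" for l a
  proof -
    have "sgn (l \<eta> - a) = sgn (l \<xi> - a)"
      using that assms by (auto simp: all_F_def)
    then show ?thesis
      by (auto simp: sgn_if split: if_splits)
  qed
  then show ?thesis
    unfolding P_eq[OF assms(2)] by blast
qed

text \<open>Strict inequalities persist nearby and equalities can only be lost. If none is lost, all
  signs agree, hence so does membership in every polyhedron.\<close>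

lemma tight_locally:
  obtains U where "open U" "\<xi> \<in> U" "\<And>\<eta>. \<eta> \<in> U \<Longrightarrow> tight \<eta> \<subseteq> tight \<xi>"
    "\<And>\<eta> i. \<eta> \<in> U \<Longrightarrow> tight \<xi> \<subseteq> tight \<eta> \<Longrightarrow> i < n \<Longrightarrow> \<eta> \<in> P i \<longleftrightarrow> \<xi> \<in> P i"
proof -
  obtain U where U: "open U" "\<xi> \<in> U"
    and signs: "\<forall>\<eta>\<in>U. \<forall>(l, a)\<in>all_F. l \<xi> \<noteq> a \<longrightarrow> sgn (l \<eta> - a) = sgn (l \<xi> - a)"
  proof -
    have "\<exists>U. open U \<and> \<xi> \<in> U \<and> (\<forall>\<eta>\<in>U. \<forall>(l, a)\<in>all_F. l \<xi> \<noteq> a \<longrightarrow> sgn (l \<eta> - a) = sgn (l \<xi> - a))"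
      by (rule linear_signs_locally_constant[OF finite_all_F]) (rule linear_all_F)
    then show ?thesis
      using that by (elim exE conjE)
  qed
  have sgn_eq: "sgn (l \<eta> - a) = sgn (l \<xi> - a)" if "\<eta> \<in> U" "(l, a) \<in> all_F" "l \<xi> \<noteq> a" for \<eta> l a
    using bspec[OF bspec[OF signs that(1)] that(2)] that(3) by simp
  show ?thesis
  proof (rule that[OF U])
    fix \<eta> assume \<eta>: "\<eta> \<in> U"
    show "tight \<eta> \<subseteq> tight \<xi>"
    proof
      fix p assume "p \<in> tight \<eta>"
      then obtain l a where p: "p = (l, a)" "(l, a) \<in> all_F" "l \<eta> = a"
        unfolding tight_def by blast
      have "l \<xi> = a"
        using sgn_eq[OF \<eta> p(2)] p(3) by (cases "l \<xi> = a") (simp_all add: sgn_zero_iff)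
      then show "p \<in> tight \<xi>"
        using p by (simp add: tight_def)
    qed
    fix i assume "tight \<xi> \<subseteq> tight \<eta>" "i < n"
    have "sgn (l \<eta> - a) = sgn (l \<xi> - a)" if "(l, a) \<in> all_F" for l a
    proof (cases "l \<xi> = a")
      case True
      then have "(l, a) \<in> tight \<xi>"
        unfolding tight_def using that by simp
      then have "(l, a) \<in> tight \<eta>"
        by (rule subsetD[OF \<open>tight \<xi> \<subseteq> tight \<eta>\<close>])
      then show ?thesis
        unfolding tight_def using True by simp
    qed (use sgn_eq[OF \<eta> that] in simp)
    then show "\<eta> \<in> P i \<longleftrightarrow> \<xi> \<in> P i"
      using \<open>i < n\<close> by (rule same_polyhedra)
  qed
qed

text \<open>The limit is assumed for all moduli, cosets and bumps because the right ones depend on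
  the local quasi-polynomial and are found only inside the proof.\<close>

lemma vanishes_positive:
  assumes lim: "\<And>D \<mu>1 a r. D > 0 \<Longrightarrow> \<mu>1 \<in> \<Lambda> \<Longrightarrow>
      (\<lambda>k. \<Sum>\<mu>\<in>{\<mu> \<in> \<Lambda>. bump a r (\<mu> /\<^sub>R real k) \<noteq> 0 \<and> (\<exists>y\<in>\<Lambda>. \<mu> = \<mu>1 + real D *\<^sub>R y)}.
        m (\<mu>, real k) * of_real (bump a r (\<mu> /\<^sub>R real k))) \<longlonglongrightarrow> 0"
    and "\<mu> \<in> \<Lambda>" "k \<ge> 1"
  shows "m (\<mu>, real k) = 0"
proof (rule ccontr)
  assume nonzero: "m (\<mu>, real k) \<noteq> 0"
  define bad where "bad = (\<lambda>x :: 'a \<times> nat. fst x \<in> \<Lambda> \<and> snd x \<ge> 1 \<and> m (fst x, real (snd x)) \<noteq> 0)"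
  have "bad (\<mu>, k)"
    using nonzero assms(2,3) by (simp add: bad_def)
  then have "\<exists>x. bad x \<and> (\<forall>y. bad y \<longrightarrow> card (tight (fst x /\<^sub>R real (snd x))) \<le> card (tight (fst y /\<^sub>R real (snd y))))"
    by (rule ex_has_least_nat)
  then obtain \<mu>1 k1 where bad1: "bad (\<mu>1, k1)"
    and least: "\<And>\<mu> k. bad (\<mu>, k) \<Longrightarrow> card (tight (\<mu>1 /\<^sub>R real k1)) \<le> card (tight (\<mu> /\<^sub>R real k))"
    by (metis fst_conv snd_conv surj_pair)
  have \<mu>1: "\<mu>1 \<in> \<Lambda>" "k1 \<ge> 1" "m (\<mu>1, real k1) \<noteq> 0"
    using bad1 by (auto simp: bad_def)
  define \<xi>1 where "\<xi>1 = \<mu>1 /\<^sub>R real k1"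
  obtain U where U: "open U" "\<xi>1 \<in> U"
    and tight_U: "\<And>\<eta>. \<eta> \<in> U \<Longrightarrow> tight \<eta> \<subseteq> tight \<xi>1"
    and same_U: "\<And>\<eta> i. \<eta> \<in> U \<Longrightarrow> tight \<xi>1 \<subseteq> tight \<eta> \<Longrightarrow> i < n \<Longrightarrow> \<eta> \<in> P i \<longleftrightarrow> \<xi>1 \<in> P i"
    using tight_locally by metis
  \<comment> \<open>Near \<open>\<xi>1\<close>, missing one of its equalities means having strictly
    fewer, so a nonzero value would contradict minimality.\<close>
  have m_zero: "m (\<mu>, real k) = 0"
    if "\<mu> \<in> \<Lambda>" "k \<ge> 1" "\<mu> /\<^sub>R real k \<in> U" "\<not> tight \<xi>1 \<subseteq> tight (\<mu> /\<^sub>R real k)" for \<mu> k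
  proof (rule ccontr)
    assume "m (\<mu>, real k) \<noteq> 0"
    then have "bad (\<mu>, k)"
      using that by (simp add: bad_def)
    then have "card (tight \<xi>1) \<le> card (tight (\<mu> /\<^sub>R real k))"
      unfolding \<xi>1_def by (rule least)
    then show False
      using tight_U[OF that(3)] that(4) finite_tight by (metis card_seteq order_refl)
  qed
  have m_local: "m (\<mu>, real k) = local_q \<xi>1 (\<mu>, real k)"
    if "\<mu> \<in> \<Lambda>" "k \<ge> 1" "\<mu> /\<^sub>R real k \<in> U" "tight \<xi>1 \<subseteq> tight (\<mu> /\<^sub>R real k)" for \<mu> k
    using that same_U by (intro m_eq_local_q) auto
  obtain D where "coset_expansion (ext_lattice \<Lambda>) (local_q \<xi>1) D"
    using quasi_polynomial_coset_expansion[OF ext_lattice_scale quasi_local_q] by blast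
  moreover have "(\<mu>1, real k1) \<in> ext_lattice \<Lambda>"
    using \<mu>1 by (simp add: ext_lattice_def)
  ultimately obtain Q where D: "D > 0" and Q: "poly_family Q"
    and expansion: "\<And>y t z. y \<in> ext_lattice \<Lambda> \<Longrightarrow> (\<mu>1, real k1) + real D *\<^sub>R y = t *\<^sub>R z \<Longrightarrow>
      local_q \<xi>1 ((\<mu>1, real k1) + real D *\<^sub>R y) = poly (Q z) (of_real t)"
    unfolding coset_expansion_def by blast
  \<comment> \<open>Writing (\<mu>, k) as k (\<mu> / k, 1) makes R \<xi> a polynomial in k whose
    coefficients depend only on the point \<xi> = \<mu> / k.\<close>
  define R where "R = (\<lambda>\<xi>. Q (\<xi>, 1))"
  \<comment> \<open>The coset of (\<mu>1, k1) modulo D in both components; the multiplier z is an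
    integer because k may be smaller than k1.\<close>
  define X where "X = {x :: 'a \<times> nat. fst x \<in> \<Lambda> \<and> snd x \<ge> 1 \<and>
    (\<exists>y\<in>\<Lambda>. fst x = \<mu>1 + real D *\<^sub>R y) \<and> (\<exists>z::int. int (snd x) = int k1 + int D * z)}"
  have cont_R: "continuous_on UNIV (\<lambda>\<xi>. coeff (R \<xi>) j)" for j
  proof -
    have "continuous_on UNIV (\<lambda>z. coeff (Q z) j)"
      using Q by (simp add: poly_family_def)
    then show ?thesis
      unfolding R_def by (rule continuous_on_compose2) (auto intro!: continuous_intros)
  qed
  have local_R: "local_q \<xi>1 (\<mu>, real k) = poly (R (\<mu> /\<^sub>R real k)) (of_nat k)" if X: "(\<mu>, k) \<in> X" for \<mu> k
  proof -
    obtain y z where y: "y \<in> \<Lambda>" "\<mu> = \<mu>1 + real D *\<^sub>R y" and z: "int k = int k1 + int D * z"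
      using X by (auto simp: X_def)
    have k: "real k = real k1 + real D * of_int z"
      using arg_cong[OF z, of real_of_int] by simp
    have eq: "(\<mu>1, real k1) + real D *\<^sub>R (y, of_int z) = (\<mu>, real k)"
      by (simp add: y k)
    have "local_q \<xi>1 ((\<mu>1, real k1) + real D *\<^sub>R (y, of_int z)) =
        poly (Q (\<mu> /\<^sub>R real k, 1)) (of_real (real k))"
    proof (rule expansion)
      show "(\<mu>1, real k1) + real D *\<^sub>R (y, of_int z) = real k *\<^sub>R (\<mu> /\<^sub>R real k, 1)"
        using X unfolding eq by (simp add: X_def)
    qed (use y in \<open>simp add: ext_lattice_def\<close>)
    then show ?thesis
      unfolding eq R_def by simp
  qed
  define \<Xi> where "\<Xi> = {\<mu> /\<^sub>R real k |\<mu> k. (\<mu>, k) \<in> X \<and> \<mu> /\<^sub>R real k \<in> U \<and> tight \<xi>1 \<subseteq> tight (\<mu> /\<^sub>R real k)}"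
  have X1: "(\<mu>1, k1) \<in> X"
    using \<mu>1 zero_in_lattice by (auto simp: X_def intro: bexI[of _ 0] exI[of _ 0])
  have "R \<xi>1 \<noteq> 0"
  proof
    assume "R \<xi>1 = 0"
    then have "local_q \<xi>1 (\<mu>1, real k1) = 0"
      using local_R[OF X1] by (simp add: \<xi>1_def)
    then show False
      using m_local[of \<mu>1 k1] \<mu>1 U(2) by (simp add: \<xi>1_def)
  qed
  define nz where "nz = (\<lambda>j. \<exists>\<xi>\<in>\<Xi>. coeff (R \<xi>) j \<noteq> 0)"
  have "\<xi>1 \<in> \<Xi>"
    using X1 U(2) unfolding \<Xi>_def \<xi>1_def by blast
  then have ex_nz: "\<exists>j. nz j"
    using \<open>R \<xi>1 \<noteq> 0\<close> unfolding nz_def by (meson leading_coeff_neq_0)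
  obtain deg where deg: "\<And>z. degree (Q z) \<le> deg"
    using Q by (auto simp: poly_family_def)
  have nz_le: "j \<le> deg" if "nz j" for j
    using that deg unfolding nz_def R_def by (meson le_degree order_trans)
  \<comment> \<open>The maximum is taken over all of \<open>\<Xi>\<close>, not at
    \<open>\<xi>1\<close> alone: a coefficient that vanishes at \<open>\<xi>1\<close> may be nonzero
    at neighbouring points and would dominate there.\<close>
  define J where "J = (GREATEST j. nz j)"
  have J_max: "j \<le> J" if "nz j" for j
    unfolding J_def using that nz_le by (rule Greatest_le_nat)
  have "nz J"
    unfolding J_def using ex_nz nz_le by (rule GreatestI_ex_nat)
  then obtain \<mu>0 k0 where X0: "(\<mu>0, k0) \<in> X" and U0: "\<mu>0 /\<^sub>R real k0 \<in> U"
    and tight0: "tight \<xi>1 \<subseteq> tight (\<mu>0 /\<^sub>R real k0)" and nz0: "coeff (R (\<mu>0 /\<^sub>R real k0)) J \<noteq> 0"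
    unfolding nz_def \<Xi>_def by blast
  define \<xi>0 where "\<xi>0 = \<mu>0 /\<^sub>R real k0"
  define a where "a = coeff (R \<xi>0) J"
  have "norm a > 0"
    using nz0 by (simp add: a_def \<xi>0_def)
  \<comment> \<open>The summand 1 makes the bounds strict at \<open>\<xi>0\<close>, so that they
    hold on an open neighbourhood.\<close>
  define M where "M = 1 + (\<Sum>j<J. norm (coeff (R \<xi>0) j))"
  define U' where "U' = U \<inter> {\<xi>. Re (cnj a * coeff (R \<xi>) J) > (norm a)\<^sup>2 / 2} \<inter>
    (\<Inter>j<J. {\<xi>. norm (coeff (R \<xi>) j) < M})"
  have open_U': "open U'"
    unfolding U'_def
    by (intro open_Int open_INT U open_Collect_less ballI continuous_intros continuous_on_compose2[OF cont_R] cont_R) auto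
  have "\<xi>0 \<in> U'"
  proof -
    have "norm (coeff (R \<xi>0) j) < M" if "j < J" for j
      using member_le_sum[of j "{..<J}" "\<lambda>j. norm (coeff (R \<xi>0) j)"] that by (simp add: M_def)
    moreover have "Re (cnj a * a) = (norm a)\<^sup>2"
      unfolding cmod_power2 by (simp add: power2_eq_square)
    then have "Re (cnj a * a) > (norm a)\<^sup>2 / 2"
      using \<open>norm a > 0\<close> by simp
    ultimately show ?thesis
      using U0 by (simp add: U'_def a_def \<xi>0_def)
  qed
  then obtain r where r: "r > 0" "{x. \<forall>b\<in>B. \<bar>coord b x - coord b \<xi>0\<bar> \<le> r} \<subseteq> U'"
    using coord_box_subset_open[OF open_U'] by blast
  have in_U': "\<eta> \<in> U'" if "bump \<xi>0 r \<eta> \<noteq> 0" for \<eta>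
    by (rule subsetD[OF r(2)], rule CollectI, rule bump_nonzeroD[OF that])
  \<comment> \<open>For k \<ge> 4 J M / |a| the lower terms meet the smallness condition of
    \<open>poly_dominant_bound\<close>.\<close>
  define K where "K = nat \<lceil>4 * (real J * M) / norm a\<rceil>"
  have main_bound: "Re (cnj a * m (\<mu>, real k)) \<ge> (norm a)\<^sup>2 / 4"
    if X: "(\<mu>, k) \<in> X" and U': "\<mu> /\<^sub>R real k \<in> U'" and t: "tight \<xi>1 \<subseteq> tight (\<mu> /\<^sub>R real k)" and "k \<ge> K" for \<mu> k
  proof -
    have k: "\<mu> \<in> \<Lambda>" "k \<ge> 1"
      using X by (auto simp: X_def)
    have "\<mu> /\<^sub>R real k \<in> \<Xi>"
      using X U' t by (auto simp: \<Xi>_def U'_def)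
    \<comment> \<open>These coefficients must vanish exactly, since they multiply higher powers of
      k; this holds at points of \<open>\<Xi>\<close> by maximality of J.\<close>
    then have coeff_0: "coeff (R (\<mu> /\<^sub>R real k)) j = 0" if "j > J" for j
      using J_max[of j] that unfolding nz_def by (meson not_le)
    have "m (\<mu>, real k) = poly (R (\<mu> /\<^sub>R real k)) (of_nat k)"
      using m_local[OF k _ t] U' local_R[OF X] by (simp add: U'_def)
    moreover have "Re (cnj a * poly (R (\<mu> /\<^sub>R real k)) (of_nat k)) \<ge> (norm a)\<^sup>2 / 4"
    proof (rule poly_dominant_bound[where J = J and M = M])
      have "4 * (real J * M) / norm a \<le> real k"
        using \<open>k \<ge> K\<close> unfolding K_def by linarith
      then have "norm a * (4 * (real J * M)) \<le> norm a * (real k * norm a)"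
        using \<open>norm a > 0\<close> by (intro mult_left_mono) (simp_all add: field_simps)
      then show "norm a * (real J * M) / real k \<le> (norm a)\<^sup>2 / 4"
        using k(2) by (simp add: field_simps power2_eq_square)
    qed (use U' k coeff_0 in \<open>auto simp: U'_def less_imp_le\<close>)
    ultimately show ?thesis by simp
  qed
  define \<beta> where "\<beta> = bump \<xi>0 r \<xi>0"
  have "\<beta> > 0"
    unfolding \<beta>_def by (rule bump_pos[OF r(1)])
  let ?s = "\<lambda>k. \<Sum>\<mu>\<in>{\<mu> \<in> \<Lambda>. bump \<xi>0 r (\<mu> /\<^sub>R real k) \<noteq> 0 \<and> (\<exists>y\<in>\<Lambda>. \<mu> = \<mu>1 + real D *\<^sub>R y)}.
        m (\<mu>, real k) * of_real (bump \<xi>0 r (\<mu> /\<^sub>R real k))"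
  have sum_bound: "Re (cnj a * ?s (k0 + D * s * k0)) \<ge> (norm a)\<^sup>2 / 4 * \<beta>" if s: "s \<ge> K" for s
  proof -
    define k where "k = k0 + D * s * k0"
    have "k0 \<ge> 1"
      using X0 by (simp add: X_def)
    then have "s \<le> k"
      unfolding k_def using D by (simp add: trans_le_add2)
    then have "k \<ge> K"
      using s by simp
    have "k \<ge> 1"
      using \<open>k0 \<ge> 1\<close> by (simp add: k_def)
    obtain z0 where "int k0 = int k1 + int D * z0"
      using X0 by (auto simp: X_def)
    then have k_cong: "int k = int k1 + int D * (z0 + int s * int k0)"
      by (simp add: k_def algebra_simps)
    have in_X: "(\<mu>, k) \<in> X" if "\<mu> \<in> \<Lambda>" "\<exists>y\<in>\<Lambda>. \<mu> = \<mu>1 + real D *\<^sub>R y" for \<mu>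
      unfolding X_def using that \<open>k \<ge> 1\<close> k_cong by auto
    let ?S = "{\<mu> \<in> \<Lambda>. bump \<xi>0 r (\<mu> /\<^sub>R real k) \<noteq> 0 \<and> (\<exists>y\<in>\<Lambda>. \<mu> = \<mu>1 + real D *\<^sub>R y)}"
    let ?h = "\<lambda>\<mu>. Re (cnj a * m (\<mu>, real k)) * bump \<xi>0 r (\<mu> /\<^sub>R real k)"
    define w where "w = real (1 + D * s)"
    \<comment> \<open>The quotient of \<open>\<mu>2\<close> by k is \<open>\<xi>0\<close> for every
      s, so this summand always carries the same weight \<open>\<beta>\<close>.\<close>
    define \<mu>2 where "\<mu>2 = w *\<^sub>R \<mu>0"
    have "real k = w * real k0" "w > 0"
      by (simp_all add: k_def w_def algebra_simps add_pos_nonneg)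
    then have "inverse (real k) * w = inverse (real k0)"
      by simp
    then have quot: "\<mu>2 /\<^sub>R real k = \<xi>0"
      by (simp only: \<mu>2_def \<xi>0_def scaleR_scaleR)
    have \<mu>2: "\<mu>2 \<in> \<Lambda>" "\<exists>y\<in>\<Lambda>. \<mu>2 = \<mu>1 + real D *\<^sub>R y"
    proof -
      have "\<mu>0 \<in> \<Lambda>"
        using X0 by (simp add: X_def)
      then show "\<mu>2 \<in> \<Lambda>"
        unfolding \<mu>2_def w_def by (rule lattice_closed(3))
      obtain y where "y \<in> \<Lambda>" "\<mu>0 = \<mu>1 + real D *\<^sub>R y"
        using X0 by (auto simp: X_def)
      then have "\<mu>2 = \<mu>1 + real D *\<^sub>R (y + real s *\<^sub>R \<mu>0)"
        by (simp add: \<mu>2_def w_def algebra_simps)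
      then show "\<exists>y\<in>\<Lambda>. \<mu>2 = \<mu>1 + real D *\<^sub>R y"
        using lattice_closed(1)[OF \<open>y \<in> \<Lambda>\<close> lattice_closed(3)[OF \<open>\<mu>0 \<in> \<Lambda>\<close>]] by blast
    qed
    have "finite ?S"
      by (rule finite_subset[OF _ finite_bump_support[OF \<open>k \<ge> 1\<close>]]) blast
    \<comment> \<open>On the face the main bound applies, off the face m vanishes. Nothing cancels,
      and the sum is at least its summand at \<open>\<mu>2\<close>.\<close>
    have nonneg: "?h \<mu> \<ge> 0" if "\<mu> \<in> ?S" for \<mu>
    proof (cases "tight \<xi>1 \<subseteq> tight (\<mu> /\<^sub>R real k)")
      case True
      then have "Re (cnj a * m (\<mu>, real k)) \<ge> (norm a)\<^sup>2 / 4"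
        using that in_X in_U' \<open>k \<ge> K\<close> by (intro main_bound) auto
      then have "Re (cnj a * m (\<mu>, real k)) \<ge> 0"
        by (rule order_trans[rotated]) simp
      then show ?thesis
        by (intro mult_nonneg_nonneg bump_nonneg)
    next
      case False
      then have "m (\<mu>, real k) = 0"
        using that in_U' \<open>k \<ge> 1\<close> by (intro m_zero) (auto simp: U'_def)
      then show ?thesis by simp
    qed
    have "Re (cnj a * ?s k) = (\<Sum>\<mu>\<in>?S. ?h \<mu>)"
      unfolding sum_distrib_left Re_sum
    proof (intro sum.cong refl)
      fix \<mu>
      have "cnj a * (m (\<mu>, real k) * of_real (bump \<xi>0 r (\<mu> /\<^sub>R real k))) =
          (cnj a * m (\<mu>, real k)) * of_real (bump \<xi>0 r (\<mu> /\<^sub>R real k))"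
        by (simp only: mult.assoc)
      then show "Re (cnj a * (m (\<mu>, real k) * of_real (bump \<xi>0 r (\<mu> /\<^sub>R real k)))) = ?h \<mu>"
        by (simp only: times_complex.sel(1) Re_complex_of_real Im_complex_of_real mult_zero_right diff_zero)
    qed
    also have "\<dots> \<ge> ?h \<mu>2"
      using \<mu>2 \<open>finite ?S\<close> nonneg \<open>\<beta> > 0\<close> by (intro member_le_sum) (auto simp: quot \<beta>_def)
    also (xtrans) have "?h \<mu>2 \<ge> (norm a)\<^sup>2 / 4 * \<beta>"
      unfolding quot \<beta>_def using \<mu>2 in_X \<open>k \<ge> K\<close> \<open>\<xi>0 \<in> U'\<close> tight0
      by (intro mult_right_mono main_bound bump_nonneg) (auto simp: quot \<xi>0_def[symmetric])
    finally (xtrans) show ?thesis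
      unfolding k_def .
  qed
  have "filterlim (\<lambda>s. k0 + D * s * k0) at_top sequentially"
  proof (rule filterlim_at_top_mono[OF filterlim_ident])
    show "\<forall>\<^sub>F s in sequentially. s \<le> k0 + D * s * k0"
      using X0 D by (intro always_eventually allI) (auto simp: X_def trans_le_add2)
  qed
  then have "(\<lambda>s. cnj a * ?s (k0 + D * s * k0)) \<longlonglongrightarrow> cnj a * 0"
    by (intro tendsto_mult_left filterlim_compose[OF lim[OF D \<mu>1(1)]])
  then have "(\<lambda>s. Re (cnj a * ?s (k0 + D * s * k0))) \<longlonglongrightarrow> Re (cnj a * 0)"
    by (rule tendsto_Re)
  then have "(norm a)\<^sup>2 / 4 * \<beta> \<le> Re (cnj a * 0)"
    by (rule tendsto_lowerbound) (use sum_bound in \<open>auto simp: eventually_at_top_linorder\<close>)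
  then show False
    using \<open>\<beta> > 0\<close> \<open>norm a > 0\<close> by (simp add: mult_le_0_iff)
qed

end

section \<open>The value at the origin\<close>

lemma common_denominator:
  assumes "finite S" "S \<subseteq> \<rat>"
  shows "\<exists>N::nat. N > 0 \<and> (\<forall>x\<in>S. real N * x \<in> \<int>)"
  using assms
proof (induction S rule: finite_induct)
  case (insert x S)
  then obtain N :: nat where N: "N > 0" "\<And>y. y \<in> S \<Longrightarrow> real N * y \<in> \<int>"
    by auto
  obtain i and d :: nat where d: "d \<noteq> 0" "x = real_of_int i / real d"
    using insert.prems by (auto simp: Rats_eq_int_div_nat)
  have "real (d * N) * y \<in> \<int>" if "y \<in> insert x S" for y
  proof (cases "y = x")
    case True
    then have "real (d * N) * y = of_int (int N * i)"
      using d by simp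
    then show ?thesis
      by (simp only: Ints_of_int)
  next
    case False
    then have "real N * y \<in> \<int>"
      using that N(2) by simp
    then have "real d * (real N * y) \<in> \<int>"
      by (rule Ints_mult[OF Ints_of_nat])
    then show ?thesis
      by (simp add: mult.assoc)
  qed
  then show ?case
    using N(1) d(1) by (intro exI[of _ "d * N"]) auto
qed auto

context lattice_basis
begin

lemma lattice_simultaneous_approximation:
  assumes "M > (0::nat)"
  obtains \<mu> k where "\<mu> \<in> \<Lambda>" "k \<ge> (1::nat)" "\<And>b. b \<in> B \<Longrightarrow> \<bar>real k * coord b \<xi> - coord b \<mu>\<bar> < 1 / M"
proof -
  obtain h where h: "bij_betw h {0..<card B} B"
    using ex_bij_betw_nat_finite[OF finite_basis] by blast
  define h' where "h' = inv_into {0..<card B} h"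
  obtain k p where k: "k > 0"
    and p: "\<And>i. i < card B \<Longrightarrow> \<bar>of_int k * coord (h i) \<xi> - of_int (p i)\<bar> < 1 / M"
    using Dirichlet_approx_simult[OF assms, where \<theta> = "\<lambda>i. coord (h i) \<xi>" and n = "card B"] by metis
  define \<mu> where "\<mu> = (\<Sum>b\<in>B. of_int (p (h' b)) *\<^sub>R b)"
  have coord: "coord b \<mu> = of_int (p (h' b))" if "b \<in> B" for b
    unfolding \<mu>_def by (rule coord_sum[OF that])
  show ?thesis
  proof (rule that[of \<mu> "nat k"])
    show "\<mu> \<in> \<Lambda>"
      by (simp add: mem_lattice_iff coord)
    show "nat k \<ge> 1"
      using k by simp
    fix b assume b: "b \<in> B"
    then have "h' b < card B" "h (h' b) = b"
      using bij_betw_inv_into[OF h] bij_betw_inv_into_right[OF h] by (auto simp: h'_def bij_betw_def)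
    then show "\<bar>real (nat k) * coord b \<xi> - coord b \<mu>\<bar> < 1 / M"
      using p[of "h' b"] k coord[OF b] by simp
  qed
qed

end

context polyhedral_sum
begin

text \<open>A tight inequality takes an integral value of absolute value less than 1 at a sufficiently
  good simultaneous approximation, hence stays tight.\<close>

lemma rational_point_same_polyhedra:
  obtains \<mu> k where "\<mu> \<in> \<Lambda>" "k \<ge> (1::nat)" "\<And>i. i < n \<Longrightarrow> \<mu> /\<^sub>R real k \<in> P i \<longleftrightarrow> \<xi> \<in> P i"
proof -
  obtain U where U: "open U" "\<xi> \<in> U"
    and same_U: "\<And>\<eta> i. \<eta> \<in> U \<Longrightarrow> tight \<xi> \<subseteq> tight \<eta> \<Longrightarrow> i < n \<Longrightarrow> \<eta> \<in> P i \<longleftrightarrow> \<xi> \<in> P i"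
    using tight_locally by metis
  obtain r where r: "r > 0" "{x. \<forall>b\<in>B. \<bar>coord b x - coord b \<xi>\<bar> \<le> r} \<subseteq> U"
    using coord_box_subset_open[OF U] by blast
  define S where "S = (\<Union>(l, a)\<in>all_F. insert a (l ` B))"
  have "finite S"
    unfolding S_def using finite_all_F finite_basis by auto
  moreover have "S \<subseteq> \<rat>"
    unfolding S_def all_F_def using rational_F basis_in_lattice by fastforce
  ultimately obtain N :: nat where "N > 0" and N: "\<And>x. x \<in> S \<Longrightarrow> real N * x \<in> \<int>"
    using common_denominator[of S] by blast
  define T where "T = (\<Sum>(l, a)\<in>all_F. real N * (\<Sum>b\<in>B. \<bar>l b\<bar>))"
  \<comment> \<open>M \<ge> 1 / r keeps \<mu> / k in the box inside \<open>U\<close>. M > T makes N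
    l(\<mu>) - k N a smaller than 1 in absolute value; T sums over all inequalities just to dominate
    each one.\<close>
  define M where "M = nat \<lceil>max (1 / r) T\<rceil> + 1"
  have M: "M > 0" "1 / r \<le> M" "T < M"
    unfolding M_def by (auto, linarith+)
  obtain \<mu> k where \<mu>: "\<mu> \<in> \<Lambda>" and k: "k \<ge> (1::nat)"
    and close: "\<And>b. b \<in> B \<Longrightarrow> \<bar>real k * coord b \<xi> - coord b \<mu>\<bar> < 1 / M"
    using lattice_simultaneous_approximation[OF M(1)] by metis
  have "\<mu> /\<^sub>R real k \<in> U"
  proof (rule subsetD[OF r(2)], rule CollectI, rule ballI)
    fix b assume "b \<in> B"
    have "\<bar>coord b (\<mu> /\<^sub>R real k) - coord b \<xi>\<bar> * real k = \<bar>real k * coord b \<xi> - coord b \<mu>\<bar>"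
      using k by (simp add: abs_mult_pos'[symmetric] abs_minus_commute field_simps)
    also have "\<dots> \<le> 1 / M"
      using close[OF \<open>b \<in> B\<close>] by simp
    also have "\<dots> \<le> r"
      using M r(1) by (simp add: field_simps)
    also have "\<dots> \<le> r * real k"
      using k r(1) by simp
    finally show "\<bar>coord b (\<mu> /\<^sub>R real k) - coord b \<xi>\<bar> \<le> r"
      using k by simp
  qed
  moreover have "tight \<xi> \<subseteq> tight (\<mu> /\<^sub>R real k)"
  proof
    fix p assume "p \<in> tight \<xi>"
    then obtain l a where p: "p = (l, a)" "(l, a) \<in> all_F" "l \<xi> = a"
      by (auto simp: tight_def)
    have l: "linear l"
      using linear_all_F p(2) .
    have int: "real N * a \<in> \<int>" "\<And>b. b \<in> B \<Longrightarrow> real N * l b \<in> \<int>"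
      by (auto intro!: N bexI[OF _ p(2)] simp: S_def)
    have "real N * l \<mu> = (\<Sum>b\<in>B. coord b \<mu> * (real N * l b))"
      unfolding linear_coord_expansion[OF l, of \<mu>] sum_distrib_left by (simp add: mult_ac)
    also have "\<dots> \<in> \<int>"
      using \<mu> by (intro Ints_sum Ints_mult[OF _ int(2)]) (auto simp: mem_lattice_iff)
    finally have "real N * l \<mu> - real k * (real N * a) \<in> \<int>"
      by (rule Ints_diff[OF _ Ints_mult[OF Ints_of_nat int(1)]])
    moreover have "\<bar>real N * l \<mu> - real k * (real N * a)\<bar> < 1"
    proof -
      have "l \<mu> - real k * a = (\<Sum>b\<in>B. (coord b \<mu> - real k * coord b \<xi>) * l b)"
        unfolding p(3)[symmetric] linear_coord_expansion[OF l, of \<mu>] linear_coord_expansion[OF l, of \<xi>]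
        by (simp add: sum_subtractf sum_distrib_left algebra_simps)
      also have "\<bar>\<dots>\<bar> \<le> (\<Sum>b\<in>B. 1 / M * \<bar>l b\<bar>)"
      proof (rule order_trans[OF sum_abs sum_mono])
        fix b assume "b \<in> B"
        then show "\<bar>(coord b \<mu> - real k * coord b \<xi>) * l b\<bar> \<le> 1 / M * \<bar>l b\<bar>"
          unfolding abs_mult using close[of b] by (intro mult_right_mono) (auto simp: abs_minus_commute)
      qed
      finally have "real N * \<bar>l \<mu> - real k * a\<bar> \<le> real N * (\<Sum>b\<in>B. 1 / M * \<bar>l b\<bar>)"
        by (intro mult_left_mono) auto
      also have "\<dots> = real N * (\<Sum>b\<in>B. \<bar>l b\<bar>) / M"
        by (simp add: sum_distrib_left sum_divide_distrib)
      also have "\<dots> \<le> T / M"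
      proof -
        have "(case (l, a) of (l, a) \<Rightarrow> real N * (\<Sum>b\<in>B. \<bar>l b\<bar>)) \<le> T"
          unfolding T_def using finite_all_F p(2)
          by (intro member_le_sum) (auto intro!: mult_nonneg_nonneg sum_nonneg)
        then show ?thesis
          by (intro divide_right_mono) auto
      qed
      also have "\<dots> < 1"
        using M by simp
      also have "real N * \<bar>l \<mu> - real k * a\<bar> = \<bar>real N * l \<mu> - real k * (real N * a)\<bar>"
      proof -
        have "real N * l \<mu> - real k * (real N * a) = real N * (l \<mu> - real k * a)"
          by (simp add: algebra_simps)
        then show ?thesis
          by (simp only: abs_mult abs_of_nat)
      qed
      finally show ?thesis .
    qed
    ultimately have "real N * l \<mu> - real k * (real N * a) = 0"
      by (rule Ints_nonzero_abs_less1)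
    then have "real N * (l \<mu> - real k * a) = 0"
      by (simp add: algebra_simps)
    then have "l \<mu> = real k * a"
      using \<open>N > 0\<close> by simp
    then have "l (\<mu> /\<^sub>R real k) = a"
      using k by (simp add: linear_scale[OF l])
    then show "p \<in> tight (\<mu> /\<^sub>R real k)"
      using p by (simp add: tight_def)
  qed
  ultimately show ?thesis
    using that[OF \<mu> k] same_U by blast
qed

text \<open>On a ray through a rational point of the same polyhedra, the local quasi-polynomial
  equals m at all positive multiples and so vanishes there. Along multiples of D it is a polynomial
  with infinitely many zeros, hence zero also at parameter 0.\<close>

lemma local_q_origin:
  assumes zero: "\<And>\<mu> k. \<mu> \<in> \<Lambda> \<Longrightarrow> k \<ge> 1 \<Longrightarrow> m (\<mu>, real k) = 0"
  shows "local_q \<xi> (0, 0) = 0"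
proof -
  obtain \<mu> k where \<mu>: "\<mu> \<in> \<Lambda>" and k: "k \<ge> (1::nat)"
    and same: "\<And>i. i < n \<Longrightarrow> \<mu> /\<^sub>R real k \<in> P i \<longleftrightarrow> \<xi> \<in> P i"
    using rational_point_same_polyhedra by metis
  define x where "x = (\<mu>, real k)"
  have ray: "local_q \<xi> (real j *\<^sub>R x) = 0" if "j \<ge> 1" for j
  proof -
    have "real j *\<^sub>R x = (real j *\<^sub>R \<mu>, real (j * k))"
      by (simp add: x_def)
    moreover have "m (real j *\<^sub>R \<mu>, real (j * k)) = local_q \<xi> (real j *\<^sub>R \<mu>, real (j * k))"
    proof (intro m_eq_local_q lattice_closed(3) \<mu>)
      show "j * k \<ge> 1"
        using k that by simp
      have "inverse (real (j * k)) * real j = inverse (real k)"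
        using that by simp
      then have quot: "(real j *\<^sub>R \<mu>) /\<^sub>R real (j * k) = \<mu> /\<^sub>R real k"
        by (simp only: scaleR_scaleR)
      show "(real j *\<^sub>R \<mu>) /\<^sub>R real (j * k) \<in> P i \<longleftrightarrow> \<xi> \<in> P i" if "i < n" for i
        unfolding quot by (rule same[OF that])
    qed
    moreover have "m (real j *\<^sub>R \<mu>, real (j * k)) = 0"
      using \<mu> k that by (intro zero lattice_closed(3)) auto
    ultimately show ?thesis by simp
  qed
  have x: "x \<in> ext_lattice \<Lambda>" and origin: "0 \<in> ext_lattice \<Lambda>"
    using \<mu> zero_in_lattice by (auto simp: x_def ext_lattice_def zero_prod_def)
  \<comment> \<open>The expansion is used on the coset of 0, which contains the points D j x as well
    as the origin.\<close>
  obtain D where "coset_expansion (ext_lattice \<Lambda>) (local_q \<xi>) D"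
    using quasi_polynomial_coset_expansion[OF ext_lattice_scale quasi_local_q] by blast
  then obtain Q where D: "D > 0"
    and expansion: "\<And>y t z. y \<in> ext_lattice \<Lambda> \<Longrightarrow> 0 + real D *\<^sub>R y = t *\<^sub>R z \<Longrightarrow>
      local_q \<xi> (0 + real D *\<^sub>R y) = poly (Q z) (of_real t)"
    using origin unfolding coset_expansion_def by blast
  have "poly (Q x) (of_nat (D * j)) = 0" if "j \<ge> 1" for j
  proof -
    have "local_q \<xi> (0 + real D *\<^sub>R (real j *\<^sub>R x)) = poly (Q x) (of_real (real (D * j)))"
      using x by (intro expansion ext_lattice_scale) simp_all
    moreover have "local_q \<xi> (real (D * j) *\<^sub>R x) = 0"
      using D that by (intro ray) simp
    ultimately show ?thesis by simp
  qed
  then have "(\<lambda>j. of_nat (D * j)) ` {1..} \<subseteq> {z. poly (Q x) z = 0}"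
    by auto
  moreover have "infinite ((\<lambda>j. of_nat (D * j) :: complex) ` {1..})"
    using D by (subst finite_image_iff) (auto simp: inj_on_def infinite_Ici)
  ultimately have "Q x = 0"
    using poly_roots_finite finite_subset by blast
  then have "local_q \<xi> (0 + real D *\<^sub>R 0) = poly 0 (of_real 0)"
    using expansion[OF origin, of 0 x] by simp
  then show ?thesis
    by (simp add: zero_prod_def)
qed

lemma closed_P: "i < n \<Longrightarrow> closed (P i)"
  and convex_P: "i < n \<Longrightarrow> convex (P i)"
proof -
  assume i: "i < n"
  have P: "P i = (\<Inter>p\<in>F i. fst p -` {..snd p})"
    unfolding P_eq[OF i] by (auto simp: case_prod_unfold)
  have lin: "linear (fst p)" if "p \<in> F i" for p
    using linear_F[OF i, of "fst p" "snd p"] that by simp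
  show "closed (P i)"
    unfolding P by (intro closed_INT ballI closed_vimage continuous_on_linear_functional lin) auto
  show "convex (P i)"
    unfolding P by (intro convex_INT convex_linear_vimage lin) auto
qed

lemma vanishes_origin:
  assumes zero: "\<And>\<mu> k. \<mu> \<in> \<Lambda> \<Longrightarrow> k \<ge> 1 \<Longrightarrow> m (\<mu>, real k) = 0"
  shows "m (0, 0) = 0"
proof -
  let ?a = "\<lambda>i. c i * q i (0, 0)"
  have relation: "(\<Sum>i<n. if \<xi> \<in> P i then ?a i else 0) = 0" for \<xi>
  proof -
    have "(\<Sum>i<n. if \<xi> \<in> P i then ?a i else 0) = local_q \<xi> (0, 0)"
      unfolding local_q_def by (intro sum.mono_neutral_cong_right) auto
    then show ?thesis
      using local_q_origin[OF zero] by simp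
  qed
  define point where "point i = (SOME x. x \<in> P i)" for i
  have point: "point i \<in> P i" if "P i \<noteq> {}" for i
    unfolding point_def using that by (simp add: some_in_eq)
  \<comment> \<open>Intersecting with the hull of one chosen point per polyhedron makes all sets
    compact and empties none of the nonempty ones. The arbitrary points chosen for empty polyhedra
    merely enlarge C.\<close>
  define C where "C = convex hull (point ` {..<n})"
  have "compact C" "convex C"
    unfolding C_def by (auto intro: finite_imp_compact_convex_hull)
  have "(\<Sum>i<n. if P i \<inter> C \<noteq> {} then ?a i else 0) = 0"
  proof (rule euler_relation_compact_convex[where Ls = "coord ` B"])
    fix i assume "i \<in> {..<n}"
    then show "compact (P i \<inter> C) \<and> convex (P i \<inter> C)"
      using \<open>compact C\<close> \<open>convex C\<close> closed_P convex_P by (simp add: closed_Int_compact convex_Int)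
  next
    fix x
    \<comment> \<open>Inside C this is the relation for the polyhedra themselves; outside C every
      term is 0.\<close>
    show "(\<Sum>i<n. if x \<in> P i \<inter> C then ?a i else 0) = 0"
      using relation[of x] by (cases "x \<in> C") simp_all
  next
    fix x y assume "\<forall>l\<in>coord ` B. l x = l y"
    then show "x = y"
      by (intro coord_eqI) auto
  qed (use finite_basis linear_coord continuous_on_linear_functional in auto)
  also have "(\<Sum>i<n. if P i \<inter> C \<noteq> {} then ?a i else 0) = m (0, 0)"
    unfolding m_origin
  proof (intro sum.cong refl)
    fix i assume "i \<in> {..<n}"
    then have "point i \<in> C"
      unfolding C_def by (intro hull_inc) auto
    then have "P i \<inter> C \<noteq> {} \<longleftrightarrow> P i \<noteq> {}"
      using point by blast
    then show "(if P i \<inter> C \<noteq> {} then ?a i else 0) = (if P i \<noteq> {} then ?a i else 0)"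
      by simp
  qed
  finally show ?thesis .
qed

end

theorem theorem1p8:
  fixes \<Lambda> :: "'a::real_normed_vector set"
    and m :: "'a \<times> real \<Rightarrow> complex"
  assumes "is_lattice \<Lambda>"
    and "m \<in> space_S \<Lambda>"
  shows "(\<forall>g\<in>torus \<Lambda>. finite_order \<Lambda> g \<longrightarrow> twist g m \<in> space_S \<Lambda>) \<and>
    ((\<forall>g\<in>torus \<Lambda>. finite_order \<Lambda> g \<longrightarrow> A_zero \<Lambda> (twist g m)) \<longrightarrow> m = (\<lambda>_. 0))"
proof (intro conjI ballI impI)
  fix g assume "g \<in> torus \<Lambda>" "finite_order \<Lambda> g"
  then show "twist g m \<in> space_S \<Lambda>"
    using assms(2) by (rule twist_in_space_S)
next
  assume A: "\<forall>g\<in>torus \<Lambda>. finite_order \<Lambda> g \<longrightarrow> A_zero \<Lambda> (twist g m)"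
  obtain B where B: "finite B" "independent B" "span B = UNIV"
    "\<Lambda> = range (\<lambda>c :: 'a \<Rightarrow> int. \<Sum>b\<in>B. of_int (c b) *\<^sub>R b)"
    using assms(1) unfolding is_lattice_def by blast
  obtain n c q P where q: "\<And>i. i < (n::nat) \<Longrightarrow> quasi_polynomial (ext_lattice \<Lambda>) (q i)"
    and P: "\<And>i. i < n \<Longrightarrow> rational_polyhedron \<Lambda> (P i)"
    and m: "m = (\<lambda>x. \<Sum>i<n. c i * restrict_cone \<Lambda> (q i) (P i) x)"
    using assms(2) unfolding space_S_def by blast
  \<comment> \<open>Packaging the description of P i as one predicate lets a single choice provide
    \<open>F\<close> for all i < n.\<close>
  define R where "R = (\<lambda>i F. finite F \<and>
      (\<forall>(l, a)\<in>F. l \<in> dual_space \<and> (\<forall>\<mu>\<in>\<Lambda>. l \<mu> \<in> \<rat>) \<and> a \<in> \<rat>) \<and> P i = {x. \<forall>(l, a)\<in>F. l x \<le> a})"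
  have "\<exists>F. R i F" if "i < n" for i
    using P[OF that] unfolding rational_polyhedron_def R_def .
  then obtain F where F: "\<And>i. i < n \<Longrightarrow> R i (F i)"
    by metis
  interpret polyhedral_sum B \<Lambda> n c q F P m
  proof (intro polyhedral_sum.intro lattice_basis.intro polyhedral_sum_axioms.intro)
    fix i assume i: "i < n"
    show "finite (F i)"
      using F[OF i] unfolding R_def by (elim conjE)
    show "P i = {x. \<forall>(l, a)\<in>F i. l x \<le> a}"
      using F[OF i] unfolding R_def by (elim conjE)
    fix l a assume la: "(l, a) \<in> F i"
    have "\<forall>(l, a)\<in>F i. l \<in> dual_space \<and> (\<forall>\<mu>\<in>\<Lambda>. l \<mu> \<in> \<rat>) \<and> a \<in> \<rat>"
      using F[OF i] unfolding R_def by (elim conjE)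
    from bspec[OF this la] show "linear l" "(\<forall>\<mu>\<in>\<Lambda>. l \<mu> \<in> \<rat>) \<and> a \<in> \<rat>"
      by (simp_all add: dual_space_def)
  qed (fact B q m)+
  have positive: "m (\<mu>, real k) = 0" if "\<mu> \<in> \<Lambda>" "k \<ge> 1" for \<mu> k
    using coset_sum_tendsto_0 A that by (intro vanishes_positive) auto
  show "m = (\<lambda>_. 0)"
  proof
    fix x :: "'a \<times> real"
    obtain \<mu> t where x: "x = (\<mu>, t)"
      by (cases x)
    \<comment> \<open>Beyond the trivial zeros there remain the apex and the integer levels t > 0,
      where t is \<open>real (nat z)\<close>.\<close>
    show "m x = 0"
    proof (cases "\<mu> \<notin> \<Lambda> \<or> t \<notin> \<int> \<or> t < 0 \<or> t = 0 \<and> \<mu> \<noteq> 0")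
      case True
      then show ?thesis
        unfolding x by (rule m_eq_0)
    next
      case False
      then obtain z where z: "t = of_int z"
        by (auto elim: Ints_cases)
      show ?thesis
      proof (cases "t = 0")
        case True
        then show ?thesis
          using False vanishes_origin[OF positive] by (simp add: x)
      next
        case nonzero: False
        then have "m (\<mu>, real (nat z)) = 0"
          using False z by (intro positive) auto
        then show ?thesis
          using False z by (simp add: x)
      qed
    qed
  qed
qed

end
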